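(* Let $\mu>0$ and let $(x^k)_{k\in\mathbb{N}}$ and $(\alpha_k)_{k\in\mathbb{N}}$ be the sequences generated by the FBS method for the problem $\min_{x\in\mathbb{R}^n}F_1(x):=f(x)+\mu\|x\|_1$. Suppose that the solution set $S^*$ is not empty, that $(x^k)_{k\in\mathbb{N}}$ converges to some $x^*\in S^*$, and that $f$ is $\mathcal{C}^2$ around $x^*$. Define $\mathcal{E}:=\{j\in\{1,\ldots,n\}: |(\nabla f(x^* ))_j|=\mu\}$, $K_0:=\{j\in\mathcal{E}: x^*_j=0\}$, $\mathcal{U}:=\{u\in\mathbb{R}^{\mathcal{E}}: u_j(\nabla f(x^* ))_j\le 0,\ j\in K_0\}$, and $\mathcal{H}_{\mathcal{E}}(x^* ):=[\nabla^2f(x^* )_{i,j}]_{i,j\in\mathcal{E}}$. Suppose that $$\langle\mathcal{H}_{\mathcal{E}}(x^* )u,u\rangle>0\quad\mbox{for all}\quad u\in\mathcal{U}\setminus\{0\},$$ and put $c:=\min\big\{\frac{\langle\mathcal{H}_{\mathcal{E}}(x^* )u,u\rangle}{\|u\|^2}: u\in\mathcal{U}\big\}$ with the convention $\frac00=\infty$. Then $(x^k)_{k\in\mathbb{N}}$ and $(F_1(x^k))_{k\in\mathbb{N}}$ are Q-linearly convergent to $x^*$ and $F_1(x^* )$, respectively. More precisely, for any positive number $\kappa$ smaller than $c$ there exists $K\in\mathbb{N}$ such that $$\|x^{k+1}-x^*\|\le\frac{1}{\sqrt{1+\alpha\kappa}}\|x^k-x^*\|,\qquad |F_1(x^{k+1})-F_1(x^*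 )|\le\frac{\sqrt{1+\alpha\kappa}+1}{2\sqrt{1+\alpha\kappa}}|F_1(x^k)-F_1(x^* )|$$ for any $k>K$, where $\alpha$ is any positive number smaller than $\min\big\{\frac{\alpha_K}{2},\frac{\theta}{2\lambda_{\max}(\nabla^2f(x^* ))}\big\}$ and $\lambda_{\max}(\nabla^2 f(x^* ))$ is the biggest eigenvalue of $\nabla^2f(x^* )$.
   Context: Let $g:=\mu\|\cdot\|_1$, $F_1=f+g$, and let $S^*$ be the set of minimizers of $F_1$. Standing assumptions: $f:\mathbb{R}^n\to\mathbb{R}\cup\{+\infty\}$ is proper, lower semicontinuous and convex with $\mathrm{int}(\mathrm{dom}\, f)\neq\emptyset$; and for any $x\in\mathrm{int}(\mathrm{dom}\, f)$ the sublevel set $\{F_1\le F_1(x)\}$ is contained in $\mathrm{int}(\mathrm{dom}\, f)$ and $f$ is continuously differentiable at any point of this sublevel set. Proximal operator: $\mathrm{prox}_{g}(z):=(\mathrm{Id}+\partial g)^{-1}(z)$. For $x\in\mathrm{int}(\mathrm{dom}\, f)$ and $\alpha>0$ put $J(x,\alpha):=\mathrm{prox}_{\alpha g}(x-\alpha\nabla f(x))$. Line search $LS(x,\sigma,\theta)$ (Beck–Teboulle), for $\sigma>0$, $\theta\in(0,1)$: start with $\alpha=\sigma$; while $f(J(x,\alpha))>f(x)+\langle\nabla f(x),J(x,\alpha)-x\rangle+\frac{1}{2\alpha}\|x-J(x,\alpha)\|^2$, replace $\alpha$ by $\theta\alpha$; output $\alpha$. FBS method: fix $\sigma>0$, $\theta\in(0,1)$,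 $x^0\in\mathrm{int}(\mathrm{dom}\, f)$, $\alpha_{-1}:=\sigma$, and for $k=0,1,2,\dots$ set $\alpha_k:=LS(x^k,\alpha_{k-1},\theta)$ and $x^{k+1}:=J(x^k,\alpha_k)$. A sequence $(z^k)$ is Q-linearly convergent to $z^*$ if there are $\rho\in(0,1)$ and $K\in\mathbb{N}$ with $\|z^{k+1}-z^*\|\le\rho\|z^k-z^*\|$ for all $k\ge K$. If $\lambda_{\max}(\nabla^2f(x^* ))=0$, the quotient $\frac{\theta}{2\lambda_{\max}(\nabla^2f(x^* ))}$ is read as $+\infty$. *)

theory Defs
  imports "HOL-Analysis.Analysis" "HOL-Library.While_Combinator"
begin

section \<open>Extended-real-valued convex functions\<close>

definition effective_domain :: "('a \<Rightarrow> ereal) \<Rightarrow> 'a set" where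
  "effective_domain f = {x. f x < \<infinity>}"

definition proper :: "('a \<Rightarrow> ereal) \<Rightarrow> bool" where
  "proper f \<longleftrightarrow> (\<forall>x. f x \<noteq> -\<infinity>) \<and> effective_domain f \<noteq> {}"

definition lower_semicontinuous :: "('a::topological_space \<Rightarrow> ereal) \<Rightarrow> bool" where
  "lower_semicontinuous f \<longleftrightarrow> (\<forall>x. f x \<le> Liminf (at x) f)"

text \<open>Only used together with \<^const>\<open>proper\<close>, so that the right-hand side is never of the form
  \<open>\<infinity> - \<infinity>\<close>.  For \<open>u = 0\<close> note that \<open>0 * \<infinity> = 0\<close> in \<^typ>\<open>ereal\<close>.\<close>

definition convex_fun :: "('a::real_vector \<Rightarrow> ereal) \<Rightarrow> bool" where
  "convex_fun f \<longleftrightarrow> (\<forall>x y u v. 0 \<le> u \<longrightarrow> 0 \<le> v \<longrightarrow> u + v = 1 \<longrightarrow>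
     f (u *\<^sub>R x + v *\<^sub>R y) \<le> ereal u * f x + ereal v * f y)"

definition minimizers :: "('a \<Rightarrow> ereal) \<Rightarrow> 'a set" where
  "minimizers F = {x. \<forall>y. F x \<le> F y}"


section \<open>Derivatives\<close>

text \<open>The gradient and the Hessian are those of the real-valued function \<^term>\<open>real_of_ereal \<circ> f\<close>.
  They are only meaningful where \<open>f\<close> is finite on a neighbourhood, which is why finiteness is part
  of the two smoothness notions below.\<close>

definition grad :: "(real^'n \<Rightarrow> ereal) \<Rightarrow> real^'n \<Rightarrow> real^'n" where
  "grad f x = (THE D. GDERIV (real_of_ereal \<circ> f) x :> D)"

definition hessian :: "(real^'n \<Rightarrow> ereal) \<Rightarrow> real^'n \<Rightarrow> real^'n^'n" where
  "hessian f x = jacobian (grad f) (at x)"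

definition continuously_differentiable_at :: "(real^'n \<Rightarrow> ereal) \<Rightarrow> real^'n \<Rightarrow> bool" where
  "continuously_differentiable_at f x \<longleftrightarrow>
     (\<forall>\<^sub>F y in nhds x. \<bar>f y\<bar> \<noteq> \<infinity> \<and> (real_of_ereal \<circ> f) differentiable (at y)) \<and>
     isCont (grad f) x"

definition C2_around :: "(real^'n \<Rightarrow> ereal) \<Rightarrow> real^'n \<Rightarrow> bool" where
  "C2_around f x \<longleftrightarrow> (\<exists>V. open V \<and> x \<in> V \<and>
     (\<forall>y\<in>V. \<bar>f y\<bar> \<noteq> \<infinity> \<and> (real_of_ereal \<circ> f) differentiable (at y) \<and>
            grad f differentiable (at y)) \<and>
     continuous_on V (hessian f))"

text \<open>Only applied to symmetric matrices, whose complex eigenvalues are all real.\<close>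

definition eigenvalues :: "real^'n^'n \<Rightarrow> real set" where
  "eigenvalues A = {l. \<exists>v. v \<noteq> 0 \<and> A *v v = l *\<^sub>R v}"

definition max_eigenvalue :: "real^'n^'n \<Rightarrow> real" where
  "max_eigenvalue A = Max (eigenvalues A)"


section \<open>The problem and its standing assumptions\<close>

definition norm1 :: "real^'n \<Rightarrow> real" where
  "norm1 x = (\<Sum>j\<in>UNIV. \<bar>x $ j\<bar>)"

definition F1 :: "(real^'n \<Rightarrow> ereal) \<Rightarrow> real \<Rightarrow> real^'n \<Rightarrow> ereal" where
  "F1 f \<mu> x = f x + ereal (\<mu> * norm1 x)"

definition standing_assumptions :: "(real^'n \<Rightarrow> ereal) \<Rightarrow> real \<Rightarrow> bool" where
  "standing_assumptions f \<mu> \<longleftrightarrow>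
     proper f \<and> lower_semicontinuous f \<and> convex_fun f \<and>
     interior (effective_domain f) \<noteq> {} \<and>
     (\<forall>x \<in> interior (effective_domain f).
        {y. F1 f \<mu> y \<le> F1 f \<mu> x} \<subseteq> interior (effective_domain f) \<and>
        (\<forall>y \<in> {y. F1 f \<mu> y \<le> F1 f \<mu> x}. continuously_differentiable_at f y))"


section \<open>The forward-backward splitting method\<close>

definition subdifferential :: "('a::real_inner \<Rightarrow> real) \<Rightarrow> 'a \<Rightarrow> 'a set" where
  "subdifferential g p = {v. \<forall>y. g p + v \<bullet> (y - p) \<le> g y}"

text \<open>The resolvent \<open>(Id + \<partial>g)\<^sup>-\<^sup>1\<close>, which is single-valued for convex \<open>g\<close>.\<close>

definition prox :: "('a::real_inner \<Rightarrow> real) \<Rightarrow> 'a \<Rightarrow> 'a" where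
  "prox g z = (THE p. \<exists>v \<in> subdifferential g p. p + v = z)"

definition J :: "(real^'n \<Rightarrow> ereal) \<Rightarrow> real \<Rightarrow> real^'n \<Rightarrow> real \<Rightarrow> real^'n" where
  "J f \<mu> x \<alpha> = prox (\<lambda>y. \<alpha> * (\<mu> * norm1 y)) (x - \<alpha> *\<^sub>R grad f x)"

text \<open>The comparison is made in \<^typ>\<open>ereal\<close>: a trial point outside the domain of \<open>f\<close> is rejected.\<close>

definition LS :: "(real^'n \<Rightarrow> ereal) \<Rightarrow> real \<Rightarrow> real^'n \<Rightarrow> real \<Rightarrow> real \<Rightarrow> real" where
  "LS f \<mu> x \<sigma> \<theta> = while
     (\<lambda>\<alpha>. f (J f \<mu> x \<alpha>) > f x +
        ereal (grad f x \<bullet> (J f \<mu> x \<alpha> - x) + 1 / (2 * \<alpha>) * (norm (x - J f \<mu> x \<alpha>))\<^sup>2))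
     (\<lambda>\<alpha>. \<theta> * \<alpha>) \<sigma>"

definition FBS ::
  "(real^'n \<Rightarrow> ereal) \<Rightarrow> real \<Rightarrow> real \<Rightarrow> real \<Rightarrow> (nat \<Rightarrow> real^'n) \<Rightarrow> (nat \<Rightarrow> real) \<Rightarrow> bool" where
  "FBS f \<mu> \<sigma> \<theta> x \<alpha> \<longleftrightarrow>
     0 < \<sigma> \<and> 0 < \<theta> \<and> \<theta> < 1 \<and> x 0 \<in> interior (effective_domain f) \<and>
     (\<forall>k. \<alpha> k = LS f \<mu> (x k) (if k = 0 then \<sigma> else \<alpha> (k - 1)) \<theta> \<and>
          x (Suc k) = J f \<mu> (x k) (\<alpha> k))"

definition Q_linearly_convergent :: "(nat \<Rightarrow> 'a::real_normed_vector) \<Rightarrow> 'a \<Rightarrow> bool" where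
  "Q_linearly_convergent z l \<longleftrightarrow>
     (\<exists>\<rho> K. 0 < \<rho> \<and> \<rho> < 1 \<and> (\<forall>k\<ge>K. norm (z (Suc k) - l) \<le> \<rho> * norm (z k - l)))"


section \<open>The second-order condition\<close>

definition index_E :: "(real^'n \<Rightarrow> ereal) \<Rightarrow> real \<Rightarrow> real^'n \<Rightarrow> 'n set" where
  "index_E f \<mu> xs = {j. \<bar>grad f xs $ j\<bar> = \<mu>}"

definition index_K0 :: "(real^'n \<Rightarrow> ereal) \<Rightarrow> real \<Rightarrow> real^'n \<Rightarrow> 'n set" where
  "index_K0 f \<mu> xs = {j \<in> index_E f \<mu> xs. xs $ j = 0}"

text \<open>With \<open>E\<close> the set \<^const>\<open>index_E\<close>, the space of vectors indexed by \<open>E\<close> is identified with the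
  subspace of vectors of \<^typ>\<open>real^'n\<close> whose components outside \<open>E\<close> vanish, and a matrix indexed by
  \<open>E \<times> E\<close> with its extension by zero.  This preserves inner products and norms.\<close>

definition cone_U :: "(real^'n \<Rightarrow> ereal) \<Rightarrow> real \<Rightarrow> real^'n \<Rightarrow> (real^'n) set" where
  "cone_U f \<mu> xs = {u. (\<forall>j. j \<notin> index_E f \<mu> xs \<longrightarrow> u $ j = 0) \<and>
                       (\<forall>j \<in> index_K0 f \<mu> xs. u $ j * grad f xs $ j \<le> 0)}"

definition hessian_E :: "(real^'n \<Rightarrow> ereal) \<Rightarrow> real \<Rightarrow> real^'n \<Rightarrow> real^'n^'n" where
  "hessian_E f \<mu> xs = (\<chi> i j. if i \<in> index_E f \<mu> xs \<and> j \<in> index_E f \<mu> xs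
                              then hessian f xs $ i $ j else 0)"

text \<open>The convention \<open>0/0 = \<infinity>\<close> is made explicit at \<open>u = 0\<close>; in particular the value is \<open>\<infinity>\<close>
  if \<open>u = 0\<close> is the only element of the cone.\<close>

definition growth_const :: "(real^'n \<Rightarrow> ereal) \<Rightarrow> real \<Rightarrow> real^'n \<Rightarrow> ereal" where
  "growth_const f \<mu> xs = (INF u \<in> cone_U f \<mu> xs.
     if u = 0 then \<infinity> else ereal (((hessian_E f \<mu> xs *v u) \<bullet> u) / (norm u)\<^sup>2))"

definition step_bound :: "(real^'n \<Rightarrow> ereal) \<Rightarrow> real \<Rightarrow> real^'n \<Rightarrow> ereal" where
  "step_bound f \<theta> xs = (if max_eigenvalue (hessian f xs) = 0 then \<infinity>
                        else ereal (\<theta> / (2 * max_eigenvalue (hessian f xs))))"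

end

theory Submission
  imports Defs
begin

text \<open>
  Write \<open>F\<close> for the objective, \<open>z\<close> for the limit of the iterates \<open>x\<^sub>k\<close>, and \<open>\<alpha>\<^sub>k\<close> for the step sizes.  Three
  facts produce the rates.

  A step accepted by the line search satisfies
  \<open>2 \<alpha>\<^sub>k (F x\<^sub>k\<^sub>+\<^sub>1 - F y) \<le> |x\<^sub>k - y|\<^sup>2 - |x\<^sub>k\<^sub>+\<^sub>1 - y|\<^sup>2\<close> for every \<open>y\<close> in the domain
  (\<open>forward_backward_inequality\<close>).  It is the sum of the gradient inequality for \<open>f\<close>, the subgradient
  inequality that characterises the proximal point, and the acceptance test.

  Near \<open>z\<close> the objective grows quadratically, \<open>F y - F z \<ge> \<kappa>/2 |y - z|\<^sup>2\<close> for each \<open>\<kappa>\<close> below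
  \<^const>\<open>growth_const\<close> (\<open>quadratic_growth\<close>).  Along a direction that leaves the cone, the
  nonsmooth part and the linear part of \<open>f\<close> together grow at first order, which beats any quadratic;
  along a direction in the cone, the second-order term of \<open>f\<close> alone gives the bound.  Taking \<open>y = z\<close> in the step inequality yields
  \<open>(1 + \<alpha>\<^sub>k \<kappa>) |x\<^sub>k\<^sub>+\<^sub>1 - z|\<^sup>2 \<le> |x\<^sub>k - z|\<^sup>2\<close>, and combining the cases \<open>y = z\<close> and \<open>y = x\<^sub>k\<close> gives the rate of the
  function values (\<open>contraction_from_growth\<close>).

  Near \<open>z\<close> every trial step at most \<open>1/L\<close> passes the test as soon as \<open>L\<close> exceeds the
  largest eigenvalue of the Hessian at \<open>z\<close>, so the nonincreasing sequence \<open>\<alpha>\<^sub>k\<close> cannot fall below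
  \<open>min \<alpha>\<^sub>K (\<theta>/L)\<close> after some index \<open>K\<close> (\<open>step_sizes_bounded_below\<close>).  This needs the largest eigenvalue to
  bound the quadratic form of the Hessian, hence the symmetry of the Hessian
  (\<open>derivative_of_gradient_symmetric\<close>, \<open>quadratic_form_le_max_eigenvalue\<close>).

  All of this presupposes that the line search stops at every iterate, including the early ones, where
  the gradient of \<open>f\<close> need not be locally Lipschitz.  It does: \<open>|J(x,\<alpha>) - x| / \<alpha>\<close> does not decrease as \<open>\<alpha>\<close>
  decreases, so the quadratic term of the test dominates the \<open>o(|J(x,\<alpha>) - x|)\<close> error of the
  linearisation (\<open>small_steps_accepted\<close>).
\<close>

section \<open>Calculus along segments\<close>

lemma gradient_along_line:
  fixes \<phi> :: "'a::real_inner \<Rightarrow> real"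
  assumes "GDERIV \<phi> (x + s *\<^sub>R d) :> D"
  shows "((\<lambda>t. \<phi> (x + t *\<^sub>R d)) has_real_derivative D \<bullet> d) (at s)"
proof -
  have "((\<lambda>t. x + t *\<^sub>R d) has_derivative (\<lambda>t. t *\<^sub>R d)) (at s)"
    by (auto intro!: derivative_eq_intros)
  from has_derivative_compose[OF this, of \<phi> "\<lambda>h. h \<bullet> D"] assms
  show ?thesis
    by (simp add: gderiv_def has_field_derivative_def inner_commute mult.commute[of "d \<bullet> D"] mult_commute_abs)
qed

text \<open>The form in which convexity and minimality are used: either one controls difference quotients from
  one side only.\<close>

lemma derivative_le_right_slope:
  fixes \<psi> :: "real \<Rightarrow> real"
  assumes der: "(\<psi> has_real_derivative D) (at 0)"
    and slope: "\<forall>\<^sub>F t in at_right 0. \<psi> t \<le> \<psi> 0 + t * C"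
  shows "D \<le> C"
proof (rule ccontr)
  assume "\<not> D \<le> C"
  have "((\<lambda>t. \<psi> t - t * C) has_real_derivative D - C) (at 0)"
    by (auto intro!: derivative_eq_intros der)
  from DERIV_pos_inc_right[OF this] \<open>\<not> D \<le> C\<close>
  have "\<forall>\<^sub>F t in at_right 0. \<psi> 0 < \<psi> t - t * C"
    unfolding eventually_at_right_field by force
  with slope have "\<forall>\<^sub>F t :: real in at_right 0. False"
    by eventually_elim simp
  then show False by simp
qed

lemma has_derivative_remainder:
  fixes G :: "'a::real_normed_vector \<Rightarrow> 'b::real_normed_vector"
  assumes "(G has_derivative A) (at x)" and "e > 0"
  obtains d where "d > 0" "\<And>h. norm h < d \<Longrightarrow> norm (G (x + h) - G x - A h) \<le> e * norm h"
proof -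
  from assms obtain d where "d > 0"
    "\<forall>y. norm (y - x) < d \<longrightarrow> norm (G y - G x - A (y - x)) \<le> e * norm (y - x)"
    unfolding has_derivative_at_alt by blast
  then have "norm (G (x + h) - G x - A h) \<le> e * norm h" if "norm h < d" for h
    using that by (metis add_diff_cancel_left')
  with \<open>d > 0\<close> show ?thesis by (rule that)
qed

text \<open>By the mean value theorem in the direction \<open>u\<close>, the second difference is
  \<open>s (G (x + \<xi>u + sv) - G (x + \<xi>u)) \<bullet> u\<close> for some \<open>\<xi> < s\<close>, and differentiability of \<open>G\<close> at the single
  point \<open>x\<close> evaluates this increment up to \<open>o(s)\<close>.\<close>

lemma second_difference_limit:
  fixes \<phi> :: "'a::real_inner \<Rightarrow> real"
  assumes grad: "\<forall>\<^sub>F y in nhds x. GDERIV \<phi> y :> G y" and A: "(G has_derivative A) (at x)"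
  shows "((\<lambda>s. (\<phi> (x + s *\<^sub>R u + s *\<^sub>R v) - \<phi> (x + s *\<^sub>R u) - \<phi> (x + s *\<^sub>R v) + \<phi> x) / s\<^sup>2)
           \<longlongrightarrow> A v \<bullet> u) (at_right 0)"
proof (rule tendstoI)
  fix e :: real assume "e > 0"
  interpret A: bounded_linear A using A by (rule has_derivative_bounded_linear)
  define c where "c = (2 * norm u + norm v) * norm u"
  have "c \<ge> 0" by (simp add: c_def)
  \<comment> \<open>The two remainders add up to at most \<open>\<eta> c s\<^sup>2\<close>, which must stay strictly below \<open>e s\<^sup>2\<close>.\<close>
  define \<eta> where "\<eta> = e / (2 * (c + 1))"
  have "\<eta> > 0" using \<open>e > 0\<close> \<open>c \<ge> 0\<close> by (simp add: \<eta>_def)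
  have "\<eta> * (c + 1) = e / 2" using \<open>c \<ge> 0\<close> by (simp add: \<eta>_def divide_simps)
  then have \<eta>c: "\<eta> * c < e" using \<open>\<eta> > 0\<close> \<open>e > 0\<close> by (simp add: algebra_simps)
  obtain d1 where "d1 > 0" and rem: "\<And>h. norm h < d1 \<Longrightarrow> norm (G (x + h) - G x - A h) \<le> \<eta> * norm h"
    using has_derivative_remainder[OF A \<open>\<eta> > 0\<close>] by blast
  obtain d2 where "d2 > 0" and gr: "\<And>y. dist y x < d2 \<Longrightarrow> GDERIV \<phi> y :> G y"
    using grad unfolding eventually_nhds_metric by blast
  define d where "d = min d1 d2 / (norm u + norm v + 1)"
  have "d > 0" using \<open>d1 > 0\<close> \<open>d2 > 0\<close> by (simp add: d_def add_nonneg_pos)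
  have "dist ((\<phi> (x + s *\<^sub>R u + s *\<^sub>R v) - \<phi> (x + s *\<^sub>R u) - \<phi> (x + s *\<^sub>R v) + \<phi> x) / s\<^sup>2) (A v \<bullet> u) < e"
    if s: "0 < s" "s < d" for s
  proof -
    have small: "norm (\<xi> *\<^sub>R u + t *\<^sub>R v) < min d1 d2" if "0 \<le> \<xi>" "\<xi> \<le> s" "0 \<le> t" "t \<le> s" for \<xi> t
    proof -
      have "norm (\<xi> *\<^sub>R u + t *\<^sub>R v) \<le> \<xi> * norm u + t * norm v"
        using norm_triangle_ineq[of "\<xi> *\<^sub>R u" "t *\<^sub>R v"] that by simp
      also have "\<dots> \<le> s * norm u + s * norm v"
        using that by (intro add_mono mult_right_mono) auto
      also have "\<dots> < s * (norm u + norm v + 1)" using s by (simp add: algebra_simps)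
      also have "\<dots> < d * (norm u + norm v + 1)"
        using s by (intro mult_strict_right_mono) (auto intro: add_nonneg_pos)
      also have "\<dots> = min d1 d2"
        by (simp add: d_def) (metis add_nonneg_pos less_irrefl norm_ge_zero zero_less_one add_nonneg_nonneg)
      finally show ?thesis .
    qed
    define g where "g = (\<lambda>t. \<phi> (x + s *\<^sub>R v + t *\<^sub>R u) - \<phi> (x + t *\<^sub>R u))"
    have "(g has_real_derivative (G (x + s *\<^sub>R v + t *\<^sub>R u) - G (x + t *\<^sub>R u)) \<bullet> u) (at t)"
      if "0 \<le> t" "t \<le> s" for t
      unfolding g_def inner_diff_left
      using small[OF that, of s] small[OF that, of 0] s
      by (intro DERIV_diff gradient_along_line gr) (auto simp: dist_norm algebra_simps)
    from MVT2[OF \<open>0 < s\<close> this] obtain \<xi> where \<xi>: "0 < \<xi>" "\<xi> < s"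
      and mv: "g s - g 0 = s * ((G (x + s *\<^sub>R v + \<xi> *\<^sub>R u) - G (x + \<xi> *\<^sub>R u)) \<bullet> u)" by auto
    define r where "r = (\<lambda>h. G (x + h) - G x - A h)"
    let ?h = "s *\<^sub>R v + \<xi> *\<^sub>R u"
    have incr: "G (x + s *\<^sub>R v + \<xi> *\<^sub>R u) - G (x + \<xi> *\<^sub>R u) = s *\<^sub>R A v + (r ?h - r (\<xi> *\<^sub>R u))"
      by (simp add: r_def A.add A.scale algebra_simps)
    have eq: "g s - g 0 - s\<^sup>2 * (A v \<bullet> u) = s * ((r ?h - r (\<xi> *\<^sub>R u)) \<bullet> u)"
      unfolding mv incr by (simp add: inner_add_left algebra_simps power2_eq_square)
    have "norm (r ?h) \<le> \<eta> * norm ?h" "norm (r (\<xi> *\<^sub>R u)) \<le> \<eta> * norm (\<xi> *\<^sub>R u)"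
      using rem[of ?h] rem[of "\<xi> *\<^sub>R u"] small[of \<xi> s] small[of \<xi> 0] \<xi> s by (auto simp: r_def add.commute)
    moreover have "norm ?h \<le> s * (norm v + norm u)" "norm (\<xi> *\<^sub>R u) \<le> s * norm u"
    proof -
      show "norm (\<xi> *\<^sub>R u) \<le> s * norm u" using \<xi> by (simp add: mult_right_mono)
      then show "norm ?h \<le> s * (norm v + norm u)"
        using norm_triangle_ineq[of "s *\<^sub>R v" "\<xi> *\<^sub>R u"] s by (simp add: algebra_simps)
    qed
    ultimately have "norm (r ?h) \<le> \<eta> * (s * (norm v + norm u))" "norm (r (\<xi> *\<^sub>R u)) \<le> \<eta> * (s * norm u)"
      using \<open>\<eta> > 0\<close> by (meson less_imp_le mult_left_mono order_trans)+
    then have "norm (r ?h - r (\<xi> *\<^sub>R u)) \<le> \<eta> * s * (2 * norm u + norm v)"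
      using norm_triangle_ineq4[of "r ?h" "r (\<xi> *\<^sub>R u)"] by (simp add: algebra_simps)
    then have "\<bar>(r ?h - r (\<xi> *\<^sub>R u)) \<bullet> u\<bar> \<le> \<eta> * s * (2 * norm u + norm v) * norm u"
      by (meson Cauchy_Schwarz_ineq2 mult_right_mono norm_ge_zero order_trans)
    then have "s * \<bar>(r ?h - r (\<xi> *\<^sub>R u)) \<bullet> u\<bar> \<le> s * (\<eta> * s * (2 * norm u + norm v) * norm u)"
      using s by (intro mult_left_mono) auto
    also have "\<dots> = \<eta> * c * s\<^sup>2" by (simp add: c_def power2_eq_square)
    also have "\<dots> < e * s\<^sup>2" using \<eta>c s by (intro mult_strict_right_mono) auto
    finally have "\<bar>g s - g 0 - s\<^sup>2 * (A v \<bullet> u)\<bar> < e * s\<^sup>2" using eq s by (simp add: abs_mult)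
    then have "\<bar>(g s - g 0) / s\<^sup>2 - A v \<bullet> u\<bar> < e"
      using s by (simp add: field_simps abs_less_iff)
    moreover have "g s - g 0 = \<phi> (x + s *\<^sub>R u + s *\<^sub>R v) - \<phi> (x + s *\<^sub>R u) - \<phi> (x + s *\<^sub>R v) + \<phi> x"
      by (simp add: g_def algebra_simps)
    ultimately show ?thesis by (simp add: dist_real_def)
  qed
  then show "\<forall>\<^sub>F s in at_right 0. dist ((\<phi> (x + s *\<^sub>R u + s *\<^sub>R v) - \<phi> (x + s *\<^sub>R u) - \<phi> (x + s *\<^sub>R v) + \<phi> x) / s\<^sup>2)
      (A v \<bullet> u) < e"
    unfolding eventually_at_right_field using \<open>d > 0\<close> by auto
qed

text \<open>The second difference is symmetric in the two directions, so its two limits agree.\<close>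

lemma derivative_of_gradient_symmetric:
  fixes \<phi> :: "'a::real_inner \<Rightarrow> real"
  assumes "\<forall>\<^sub>F y in nhds x. GDERIV \<phi> y :> G y" and "(G has_derivative A) (at x)"
  shows "A u \<bullet> v = A v \<bullet> u"
proof -
  let ?\<Delta> = "\<lambda>u v s. (\<phi> (x + s *\<^sub>R u + s *\<^sub>R v) - \<phi> (x + s *\<^sub>R u) - \<phi> (x + s *\<^sub>R v) + \<phi> x) / s\<^sup>2"
  have "?\<Delta> u v = ?\<Delta> v u" by (simp add: algebra_simps)
  with second_difference_limit[OF assms, of u v] second_difference_limit[OF assms, of v u]
  show ?thesis by (metis (lifting) tendsto_unique trivial_limit_at_right_real)
qed

text \<open>The remainder vanishes at \<open>h = 0\<close>, and its derivative along the segment is the first-order remainder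
  of \<open>G\<close>, which is small relative to \<open>h\<close>.\<close>

lemma second_order_expansion:
  fixes \<phi> :: "'a::real_inner \<Rightarrow> real"
  assumes grad: "\<forall>\<^sub>F y in nhds x. GDERIV \<phi> y :> G y" and A: "(G has_derivative A) (at x)" and "e > 0"
  obtains d where "d > 0"
    "\<And>h. norm h < d \<Longrightarrow> \<bar>\<phi> (x + h) - \<phi> x - G x \<bullet> h - (A h \<bullet> h) / 2\<bar> \<le> e * (norm h)\<^sup>2"
proof -
  interpret A: bounded_linear A using A by (rule has_derivative_bounded_linear)
  obtain d1 where "d1 > 0" and rem: "\<And>h. norm h < d1 \<Longrightarrow> norm (G (x + h) - G x - A h) \<le> e * norm h"
    using has_derivative_remainder[OF A \<open>e > 0\<close>] by blast
  obtain d2 where "d2 > 0" and gr: "\<And>y. dist y x < d2 \<Longrightarrow> GDERIV \<phi> y :> G y"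
    using grad unfolding eventually_nhds_metric by blast
  show ?thesis
  proof (rule that[of "min d1 d2"])
    show "min d1 d2 > 0" using \<open>d1 > 0\<close> \<open>d2 > 0\<close> by simp
    fix h :: 'a assume h: "norm h < min d1 d2"
    define \<psi> where "\<psi> = (\<lambda>s. \<phi> (x + s *\<^sub>R h) - s * (G x \<bullet> h) - s\<^sup>2 / 2 * (A h \<bullet> h))"
    have le: "norm (s *\<^sub>R h) \<le> norm h" if "0 \<le> s" "s \<le> 1" for s
      using that by (simp add: mult_left_le_one_le)
    have "(\<psi> has_real_derivative (G (x + s *\<^sub>R h) - G x - A (s *\<^sub>R h)) \<bullet> h) (at s)" if "0 \<le> s" "s \<le> 1" for s
    proof -
      have "dist (x + s *\<^sub>R h) x < d2" using le[OF that] h unfolding dist_norm by simp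
      from gradient_along_line[OF gr[OF this]]
      show ?thesis unfolding \<psi>_def
        by (auto intro!: derivative_eq_intros simp: A.scale inner_diff_left)
    qed
    from MVT2[OF zero_less_one this] obtain \<xi> where \<xi>: "0 < \<xi>" "\<xi> < 1"
      and mv: "\<psi> 1 - \<psi> 0 = (G (x + \<xi> *\<^sub>R h) - G x - A (\<xi> *\<^sub>R h)) \<bullet> h" by auto
    have "norm (G (x + \<xi> *\<^sub>R h) - G x - A (\<xi> *\<^sub>R h)) \<le> e * norm (\<xi> *\<^sub>R h)"
      using le[of \<xi>] h \<xi> by (intro rem) linarith
    also have "\<dots> \<le> e * norm h" using le[of \<xi>] \<xi> \<open>e > 0\<close> by (intro mult_left_mono) auto
    finally have "\<bar>\<psi> 1 - \<psi> 0\<bar> \<le> e * norm h * norm h"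
      unfolding mv by (meson Cauchy_Schwarz_ineq2 mult_right_mono norm_ge_zero order_trans)
    then show "\<bar>\<phi> (x + h) - \<phi> x - G x \<bullet> h - (A h \<bullet> h) / 2\<bar> \<le> e * (norm h)\<^sup>2"
      by (simp add: \<psi>_def power2_eq_square algebra_simps)
  qed
qed

text \<open>Along the segment from \<open>x\<close> to \<open>y\<close>, the derivative of the slope is at most \<open>L |y - x|\<^sup>2\<close>; two
  applications of the mean value theorem integrate this bound twice.\<close>

lemma descent_lemma:
  fixes \<phi> :: "'a::real_inner \<Rightarrow> real"
  assumes "convex B" and x: "x \<in> B" and y: "y \<in> B"
    and grad: "\<And>z. z \<in> B \<Longrightarrow> GDERIV \<phi> z :> G z"
    and der: "\<And>z. z \<in> B \<Longrightarrow> (G has_derivative A z) (at z)"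
    and bound: "\<And>z u. z \<in> B \<Longrightarrow> A z u \<bullet> u \<le> L * (norm u)\<^sup>2"
  shows "\<phi> y \<le> \<phi> x + G x \<bullet> (y - x) + L / 2 * (norm (y - x))\<^sup>2"
proof -
  define d where "d = y - x"
  have seg: "x + s *\<^sub>R d \<in> B" if "0 \<le> s" "s \<le> 1" for s
    using convexD_alt[OF \<open>convex B\<close> x y that] by (simp add: d_def algebra_simps)
  have G': "((\<lambda>s. G (x + s *\<^sub>R d) \<bullet> d) has_real_derivative A (x + s *\<^sub>R d) d \<bullet> d) (at s)"
    if "0 \<le> s" "s \<le> 1" for s
  proof -
    have *: "((\<lambda>t. x + t *\<^sub>R d) has_derivative (\<lambda>t. t *\<^sub>R d)) (at s)"
      by (auto intro!: derivative_eq_intros)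
    have lin: "bounded_linear (A (x + s *\<^sub>R d))"
      by (rule has_derivative_bounded_linear[OF der[OF seg[OF that]]])
    from has_derivative_inner_left[OF has_derivative_compose[OF * der[OF seg[OF that]]], of d]
    show ?thesis
      by (simp add: has_field_derivative_def linear_scale[OF bounded_linear.linear[OF lin]] mult_commute_abs)
  qed
  have G_le: "G (x + s *\<^sub>R d) \<bullet> d \<le> G x \<bullet> d + s * (L * (norm d)\<^sup>2)" if s: "0 < s" "s \<le> 1" for s
  proof -
    have "\<exists>z>0. z < s \<and> G (x + s *\<^sub>R d) \<bullet> d - G (x + 0 *\<^sub>R d) \<bullet> d = (s - 0) * (A (x + z *\<^sub>R d) d \<bullet> d)"
      using s by (intro MVT2 G') auto
    then obtain z where z: "0 < z" "z < s" 
      and eq: "G (x + s *\<^sub>R d) \<bullet> d - G x \<bullet> d = s * (A (x + z *\<^sub>R d) d \<bullet> d)" by auto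
    have "s * (A (x + z *\<^sub>R d) d \<bullet> d) \<le> s * (L * (norm d)\<^sup>2)"
      using s z bound[OF seg] by (intro mult_left_mono) auto
    with eq show ?thesis by linarith
  qed
  define \<psi> where "\<psi> = (\<lambda>s. \<phi> (x + s *\<^sub>R d) - s * (G x \<bullet> d) - s\<^sup>2 / 2 * (L * (norm d)\<^sup>2))"
  have "(\<psi> has_real_derivative G (x + s *\<^sub>R d) \<bullet> d - G x \<bullet> d - s * (L * (norm d)\<^sup>2)) (at s)"
    if "0 \<le> s" "s \<le> 1" for s
    unfolding \<psi>_def
    by (auto intro!: derivative_eq_intros gradient_along_line[OF grad[OF seg[OF that]]])
  from MVT2[OF zero_less_one this] obtain z where z: "0 < z" "z < 1" 
    and "\<psi> 1 - \<psi> 0 = G (x + z *\<^sub>R d) \<bullet> d - G x \<bullet> d - z * (L * (norm d)\<^sup>2)" by auto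
  with G_le[of z] have "\<psi> 1 \<le> \<psi> 0" by simp
  then show ?thesis by (simp add: \<psi>_def d_def)
qed

section \<open>The largest eigenvalue of a symmetric matrix\<close>

lemma symmetric_inner_commute:
  fixes A :: "real^'n^'n"
  assumes "transpose A = A"
  shows "(A *v u) \<bullet> v = u \<bullet> (A *v v)"
  by (metis assms dot_lmul_matrix vector_transpose_matrix)

text \<open>Eigenvectors for distinct eigenvalues are orthogonal, hence linearly independent.\<close>

lemma finite_eigenvalues_symmetric:
  fixes A :: "real^'n^'n"
  assumes "transpose A = A"
  shows "finite (eigenvalues A)"
proof -
  have "\<forall>l\<in>eigenvalues A. \<exists>v. v \<noteq> 0 \<and> A *v v = l *\<^sub>R v" by (simp add: eigenvalues_def)
  from bchoice[OF this] obtain v where v: "\<And>l. l \<in> eigenvalues A \<Longrightarrow> v l \<noteq> 0 \<and> A *v v l = l *\<^sub>R v l"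
    by blast
  have orth: "v l \<bullet> v m = 0" if "l \<in> eigenvalues A" "m \<in> eigenvalues A" "l \<noteq> m" for l m
    using symmetric_inner_commute[OF assms, of "v l" "v m"] v that by auto
  have inj: "inj_on v (eigenvalues A)"
    by (rule inj_onI) (metis orth v inner_eq_zero_iff)
  have "pairwise orthogonal (v ` eigenvalues A)"
    unfolding pairwise_def orthogonal_def using orth by auto
  moreover have "0 \<notin> v ` eigenvalues A" using v by auto
  ultimately have "finite (v ` eigenvalues A)"
    using pairwise_orthogonal_independent independent_imp_finite by blast
  with inj show ?thesis by (simp add: finite_image_iff)
qed

text \<open>The maximum \<open>M\<close> of the quadratic form over the unit sphere is itself an eigenvalue: if
  \<open>b = A u - M u\<close> were nonzero at a maximiser \<open>u\<close>, then moving from \<open>u\<close> a little in the direction \<open>b\<close> would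
  increase the Rayleigh quotient.\<close>

lemma quadratic_form_le_max_eigenvalue:
  fixes A :: "real^'n^'n"
  assumes sym: "transpose A = A"
  shows "(A *v v) \<bullet> v \<le> max_eigenvalue A * (norm v)\<^sup>2"
proof -
  define q where "q = (\<lambda>v. (A *v v) \<bullet> v)"
  have "continuous_on (sphere 0 1) q"
    unfolding q_def by (intro continuous_intros linear_continuous_on matrix_vector_mul_bounded_linear)
  moreover have "sphere (0::real^'n) 1 \<noteq> {}" by simp
  ultimately obtain u where u: "u \<in> sphere 0 1" and max: "\<And>w. w \<in> sphere 0 1 \<Longrightarrow> q w \<le> q u"
    using continuous_attains_sup[OF compact_sphere] by blast
  define M where "M = q u"
  have q_le: "q w \<le> M * (norm w)\<^sup>2" for w
  proof (cases "w = 0")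
    case False
    have "q (w /\<^sub>R norm w) \<le> M" unfolding M_def using False by (intro max) simp
    moreover have "q (w /\<^sub>R norm w) = q w / (norm w)\<^sup>2"
      by (simp add: q_def matrix_vector_mult_scaleR power2_eq_square divide_simps)
    ultimately show ?thesis using False by (simp add: divide_le_eq)
  qed (simp add: q_def)
  define b where "b = A *v u - M *\<^sub>R u"
  have "b = 0"
  proof (rule ccontr)
    assume "b \<noteq> 0"
    define c where "c = q b - M * (norm b)\<^sup>2"
    have ineq: "2 * t * (norm b)\<^sup>2 + t\<^sup>2 * c \<le> 0" for t
    proof -
      have "q (u + t *\<^sub>R b) = M + 2 * t * ((A *v u) \<bullet> b) + t\<^sup>2 * q b"
        using symmetric_inner_commute[OF sym, of b u]
        by (simp add: q_def M_def matrix_vector_right_distrib matrix_vector_mult_scaleR inner_add_left inner_add_right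
            inner_commute algebra_simps power2_eq_square)
      moreover have "(norm (u + t *\<^sub>R b))\<^sup>2 = 1 + 2 * t * (u \<bullet> b) + t\<^sup>2 * (norm b)\<^sup>2"
        using u unfolding power2_norm_eq_inner
        by (simp add: inner_add_left inner_add_right norm_eq_1 inner_commute algebra_simps power2_eq_square)
      moreover have "(A *v u) \<bullet> b = (norm b)\<^sup>2 + M * (u \<bullet> b)"
        by (simp add: b_def power2_norm_eq_inner algebra_simps inner_diff_left)
      ultimately show ?thesis using q_le[of "u + t *\<^sub>R b"] by (simp add: c_def algebra_simps)
    qed
    have "(norm b)\<^sup>2 > 0" using \<open>b \<noteq> 0\<close> by simp
    have "c \<le> 0" unfolding c_def using q_le[of b] by simp
    \<comment> \<open>Small enough for the linear term \<open>2 t |b|\<^sup>2\<close> to outweigh \<open>t\<^sup>2 c\<close>; the denominator is at least 1.\<close>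
    define t where "t = (norm b)\<^sup>2 / (1 - c)"
    have "t > 0" unfolding t_def using \<open>c \<le> 0\<close> \<open>(norm b)\<^sup>2 > 0\<close> by (intro divide_pos_pos) auto
    have "t * (1 - c) = (norm b)\<^sup>2" using \<open>c \<le> 0\<close> by (simp add: t_def)
    then have "t * c = t - (norm b)\<^sup>2" by (simp add: algebra_simps)
    moreover have "2 * t * (norm b)\<^sup>2 + t\<^sup>2 * c = t * (2 * (norm b)\<^sup>2 + t * c)"
      by (simp add: power2_eq_square algebra_simps)
    ultimately have "2 * t * (norm b)\<^sup>2 + t\<^sup>2 * c = t * ((norm b)\<^sup>2 + t)" by simp
    moreover have "t * ((norm b)\<^sup>2 + t) > 0" using \<open>t > 0\<close> by (simp add: add_nonneg_pos)
    ultimately show False using ineq[of t] by simp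
  qed
  then have "A *v u = M *\<^sub>R u" "u \<noteq> 0" using u by (auto simp: b_def)
  then have "M \<in> eigenvalues A" unfolding eigenvalues_def by auto
  then have "M \<le> max_eigenvalue A"
    unfolding max_eigenvalue_def using finite_eigenvalues_symmetric[OF sym] by simp
  then have "M * (norm v)\<^sup>2 \<le> max_eigenvalue A * (norm v)\<^sup>2" by (simp add: mult_right_mono)
  with q_le[of v] show ?thesis by (simp add: q_def)
qed

section \<open>The proximal step for the scaled absolute-value norm\<close>

lemma subdifferential_monotone:
  assumes "v \<in> subdifferential g p" and "w \<in> subdifferential g q"
  shows "(v - w) \<bullet> (p - q) \<ge> 0"
proof -
  have "g p + v \<bullet> (q - p) \<le> g q" "g q + w \<bullet> (p - q) \<le> g p"
    using assms by (auto simp: subdifferential_def)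
  then show ?thesis by (simp add: inner_diff_left inner_diff_right)
qed

text \<open>Uniqueness of the proximal point follows from monotonicity of the subdifferential.\<close>

lemma prox_eqI:
  assumes "z - p \<in> subdifferential g p"
  shows "prox g z = p"
  unfolding prox_def
proof (rule the_equality)
  show "\<exists>v\<in>subdifferential g p. p + v = z" using assms by force
  fix q assume "\<exists>v\<in>subdifferential g q. q + v = z"
  then have "z - q \<in> subdifferential g q" by (metis add_diff_cancel_left')
  from subdifferential_monotone[OF this assms] have "(p - q) \<bullet> (p - q) \<le> 0"
    by (simp add: inner_diff_left inner_diff_right inner_commute)
  then show "q = p" by (metis inner_ge_zero antisym inner_eq_zero_iff right_minus_eq)
qed

text \<open>The proximal map of \<open>l |\<cdot>|\<close> on the real line.\<close>

definition soft_threshold :: "real \<Rightarrow> real \<Rightarrow> real" where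
  "soft_threshold l z = sgn z * max (\<bar>z\<bar> - l) 0"

lemma soft_threshold_subgradient:
  assumes "0 \<le> l"
  shows "l * \<bar>soft_threshold l z\<bar> + (z - soft_threshold l z) * (y - soft_threshold l z) \<le> l * \<bar>y\<bar>"
proof -
  have "z * y \<le> l * \<bar>y\<bar>" if "\<bar>z\<bar> \<le> l"
  proof -
    have "z * y \<le> \<bar>z\<bar> * \<bar>y\<bar>" by (metis abs_ge_self abs_mult)
    with that show ?thesis by (meson abs_ge_zero mult_right_mono order_trans)
  qed
  moreover have "l * y \<le> l * \<bar>y\<bar>" "- (l * y) \<le> l * \<bar>y\<bar>"
    using assms by (auto simp: abs_if mult_nonneg_nonneg mult_nonneg_nonpos)
  ultimately show ?thesis
    by (cases "\<bar>z\<bar> \<le> l"; cases "z > 0") (auto simp: soft_threshold_def sgn_if abs_if algebra_simps)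
qed

lemma prox_norm1_subgradient:
  fixes z :: "real^'n"
  assumes "0 \<le> l"
  shows "z - prox (\<lambda>y. l * norm1 y) z \<in> subdifferential (\<lambda>y. l * norm1 y) (prox (\<lambda>y. l * norm1 y) z)"
proof -
  define p :: "real^'n" where "p = (\<chi> j. soft_threshold l (z $ j))"
  have "z - p \<in> subdifferential (\<lambda>y. l * norm1 y) p"
    unfolding subdifferential_def mem_Collect_eq
  proof
    fix y :: "real^'n"
    have "l * norm1 p + (z - p) \<bullet> (y - p) = (\<Sum>j\<in>UNIV. l * \<bar>p $ j\<bar> + (z $ j - p $ j) * (y $ j - p $ j))"
      by (simp add: norm1_def inner_vec_def sum_distrib_left sum.distrib)
    also have "\<dots> \<le> (\<Sum>j\<in>UNIV. l * \<bar>y $ j\<bar>)"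
      by (rule sum_mono) (simp add: p_def soft_threshold_subgradient[OF assms])
    finally show "l * norm1 p + (z - p) \<bullet> (y - p) \<le> l * norm1 y"
      by (simp add: norm1_def sum_distrib_left)
  qed
  then show ?thesis using prox_eqI by metis
qed

lemma norm1_diff_le: "norm1 x - norm1 y \<le> real CARD('n) * norm (x - y)" for x y :: "real^'n"
proof -
  have "norm1 x - norm1 y = (\<Sum>j\<in>UNIV. \<bar>x $ j\<bar> - \<bar>y $ j\<bar>)" by (simp add: norm1_def sum_subtractf)
  also have "\<dots> \<le> (\<Sum>j\<in>(UNIV :: 'n set). norm (x - y))"
  proof (rule sum_mono)
    fix j
    show "\<bar>x $ j\<bar> - \<bar>y $ j\<bar> \<le> norm (x - y)"
      using component_le_norm_cart[of "x - y" j] abs_triangle_ineq2[of "x $ j" "y $ j"] by simp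
  qed
  finally show ?thesis by simp
qed

lemma norm1_convex:
  assumes "0 \<le> t" "t \<le> 1"
  shows "norm1 (x + t *\<^sub>R (y - x)) \<le> norm1 x + t * (norm1 y - norm1 x)"
proof -
  have "norm1 (x + t *\<^sub>R (y - x)) \<le> (\<Sum>j\<in>UNIV. (1 - t) * \<bar>x $ j\<bar> + t * \<bar>y $ j\<bar>)"
    unfolding norm1_def
  proof (rule sum_mono)
    fix j
    have "(x + t *\<^sub>R (y - x)) $ j = (1 - t) * x $ j + t * y $ j" by (simp add: algebra_simps)
    then show "\<bar>(x + t *\<^sub>R (y - x)) $ j\<bar> \<le> (1 - t) * \<bar>x $ j\<bar> + t * \<bar>y $ j\<bar>"
      using abs_triangle_ineq[of "(1 - t) * x $ j" "t * y $ j"] assms by (simp add: abs_mult)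
  qed
  also have "\<dots> = (1 - t) * norm1 x + t * norm1 y" by (simp add: norm1_def sum.distrib sum_distrib_left)
  finally show ?thesis by (simp add: algebra_simps)
qed

text \<open>The optimality condition of the proximal step, divided by \<open>\<alpha>\<close> so that it concerns the
  subdifferential of one function for all step sizes.  Every later property of \<open>J\<close> is derived from it.\<close>

lemma J_subgradient:
  fixes x :: "real^'n"
  assumes "0 < \<alpha>" and "0 \<le> \<mu>"
  shows "(x - J f \<mu> x \<alpha>) /\<^sub>R \<alpha> - grad f x \<in> subdifferential (\<lambda>y. \<mu> * norm1 y) (J f \<mu> x \<alpha>)"
proof -
  define p where "p = J f \<mu> x \<alpha>"
  have "x - \<alpha> *\<^sub>R grad f x - p \<in> subdifferential (\<lambda>y. (\<alpha> * \<mu>) * norm1 y) p"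
    using prox_norm1_subgradient[of "\<alpha> * \<mu>" "x - \<alpha> *\<^sub>R grad f x"] assms
    by (simp add: p_def J_def mult.assoc)
  moreover have "x - \<alpha> *\<^sub>R grad f x - p = \<alpha> *\<^sub>R ((x - p) /\<^sub>R \<alpha> - grad f x)"
    using assms by (simp add: scaleR_diff_right)
  ultimately have "\<alpha> * (\<mu> * norm1 p + ((x - p) /\<^sub>R \<alpha> - grad f x) \<bullet> (y - p)) \<le> \<alpha> * (\<mu> * norm1 y)" for y
    by (simp add: subdifferential_def distrib_left mult.assoc)
  then show ?thesis
    unfolding subdifferential_def p_def using assms by simp
qed

section \<open>Termination of the line search\<close>

lemma J_displacement_le:
  fixes x :: "real^'n"
  assumes "0 < \<alpha>" and "0 \<le> \<mu>"
  shows "norm (x - J f \<mu> x \<alpha>) \<le> \<alpha> * (norm (grad f x) + \<mu> * CARD('n))"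
proof -
  define d where "d = x - J f \<mu> x \<alpha>"
  have "\<mu> * norm1 (J f \<mu> x \<alpha>) + (d /\<^sub>R \<alpha> - grad f x) \<bullet> d \<le> \<mu> * norm1 x"
    using J_subgradient[OF assms, of x f] by (simp add: subdifferential_def d_def)
  then have "(norm d)\<^sup>2 / \<alpha> \<le> grad f x \<bullet> d + \<mu> * (norm1 x - norm1 (J f \<mu> x \<alpha>))"
    by (simp add: inner_diff_left power2_norm_eq_inner divide_inverse algebra_simps)
  also have "\<dots> \<le> norm (grad f x) * norm d + \<mu> * (CARD('n) * norm d)"
    using norm1_diff_le[of x "J f \<mu> x \<alpha>"] \<open>0 \<le> \<mu>\<close>
    by (intro add_mono mult_left_mono norm_cauchy_schwarz) (simp_all add: d_def)
  finally have "norm d * norm d \<le> norm d * (\<alpha> * (norm (grad f x) + \<mu> * CARD('n)))"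
    using \<open>0 < \<alpha>\<close> by (simp add: divide_le_eq power2_eq_square algebra_simps)
  moreover have "0 \<le> \<alpha> * (norm (grad f x) + \<mu> * CARD('n))" using assms by simp
  ultimately show ?thesis by (cases "d = 0") (auto simp: d_def)
qed

text \<open>With \<open>a\<close> and \<open>b\<close> the two scaled displacements, monotonicity of the subdifferential gives
  \<open>(a - b) \<bullet> (\<beta> b - \<alpha> a) \<ge> 0\<close>, and by Cauchy-Schwarz the same for the norms:
  \<open>(|a| - |b|) (\<beta> |b| - \<alpha> |a|) \<ge> 0\<close>.  With \<open>|a| < |b|\<close> the second factor would be positive.\<close>

lemma J_displacement_ratio_antimono:
  fixes x :: "real^'n"
  assumes "0 < \<alpha>" and "\<alpha> \<le> \<beta>" and "0 \<le> \<mu>"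
  shows "norm (x - J f \<mu> x \<beta>) / \<beta> \<le> norm (x - J f \<mu> x \<alpha>) / \<alpha>"
proof (rule ccontr)
  have "0 < \<beta>" using assms by simp
  define a where "a = (x - J f \<mu> x \<alpha>) /\<^sub>R \<alpha>"
  define b where "b = (x - J f \<mu> x \<beta>) /\<^sub>R \<beta>"
  have A: "norm a = norm (x - J f \<mu> x \<alpha>) / \<alpha>" and B: "norm b = norm (x - J f \<mu> x \<beta>) / \<beta>"
    using \<open>0 < \<alpha>\<close> \<open>0 < \<beta>\<close> by (simp_all add: a_def b_def divide_inverse)
  assume "\<not> norm (x - J f \<mu> x \<beta>) / \<beta> \<le> norm (x - J f \<mu> x \<alpha>) / \<alpha>"
  then have less: "norm a < norm b" by (simp add: A B)
  have diff: "J f \<mu> x \<alpha> - J f \<mu> x \<beta> = \<beta> *\<^sub>R b - \<alpha> *\<^sub>R a"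
    using \<open>0 < \<alpha>\<close> \<open>0 < \<beta>\<close> by (simp add: a_def b_def)
  have "0 \<le> (a - b) \<bullet> (\<beta> *\<^sub>R b - \<alpha> *\<^sub>R a)"
    using subdifferential_monotone[OF J_subgradient[OF \<open>0 < \<alpha>\<close> \<open>0 \<le> \<mu>\<close>, of x f]
        J_subgradient[OF \<open>0 < \<beta>\<close> \<open>0 \<le> \<mu>\<close>, of x f]]
    by (simp add: diff flip: a_def b_def)
  also have "\<dots> = (\<alpha> + \<beta>) * (a \<bullet> b) - \<alpha> * (norm a)\<^sup>2 - \<beta> * (norm b)\<^sup>2"
    by (simp add: power2_norm_eq_inner inner_diff_left inner_diff_right inner_commute algebra_simps)
  also have "\<dots> \<le> (\<alpha> + \<beta>) * (norm a * norm b) - \<alpha> * (norm a)\<^sup>2 - \<beta> * (norm b)\<^sup>2"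
    using norm_cauchy_schwarz[of a b] \<open>0 < \<alpha>\<close> \<open>0 < \<beta>\<close> by simp
  also have "\<dots> = - ((norm b - norm a) * (\<beta> * norm b - \<alpha> * norm a))"
    by (simp add: power2_eq_square algebra_simps)
  finally have "(norm b - norm a) * (\<beta> * norm b - \<alpha> * norm a) \<le> 0" by simp
  moreover have "\<alpha> * norm a < \<beta> * norm b"
    using less assms by (intro mult_le_less_imp_less) auto
  ultimately show False using less by (simp add: mult_le_0_iff)
qed

text \<open>The negation of the loop guard in \<^const>\<open>LS\<close>.\<close>

definition accepts :: "(real^'n \<Rightarrow> ereal) \<Rightarrow> real \<Rightarrow> real^'n \<Rightarrow> real \<Rightarrow> bool" where
  "accepts f \<mu> x \<alpha> \<longleftrightarrow> f (J f \<mu> x \<alpha>) \<le> f x +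
     ereal (grad f x \<bullet> (J f \<mu> x \<alpha> - x) + 1 / (2 * \<alpha>) * (norm (x - J f \<mu> x \<alpha>))\<^sup>2)"

lemma acceptsI:
  assumes "\<bar>f x\<bar> \<noteq> \<infinity>" "\<bar>f (J f \<mu> x \<alpha>)\<bar> \<noteq> \<infinity>"
    and "real_of_ereal (f (J f \<mu> x \<alpha>)) \<le> real_of_ereal (f x) + grad f x \<bullet> (J f \<mu> x \<alpha> - x)
       + (norm (J f \<mu> x \<alpha> - x))\<^sup>2 / (2 * \<alpha>)"
  shows "accepts f \<mu> x \<alpha>"
proof -
  obtain u v where "f x = ereal u" "f (J f \<mu> x \<alpha>) = ereal v" using assms(1,2) by (auto elim!: ereal_cases)
  then show ?thesis using assms(3) by (simp add: accepts_def norm_minus_commute algebra_simps)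
qed

text \<open>If \<open>J(x,\<sigma>) = x\<close>, the first trial passes.  Otherwise \<open>|J(x,\<alpha>) - x| / \<alpha>\<close> is at least
  \<open>B = |J(x,\<sigma>) - x| / \<sigma> > 0\<close> for all smaller \<open>\<alpha>\<close>, so the quadratic term of the test is at least
  \<open>B/2 |J(x,\<alpha>) - x|\<close>.  Differentiability of \<open>f\<close> at \<open>x\<close> makes the linearisation error smaller than this
  once \<open>J(x,\<alpha>)\<close> is close to \<open>x\<close>.\<close>

lemma small_steps_accepted:
  fixes f :: "real^'n \<Rightarrow> ereal"
  assumes "\<forall>\<^sub>F y in nhds x. \<bar>f y\<bar> \<noteq> \<infinity>"
    and der: "GDERIV (real_of_ereal \<circ> f) x :> grad f x"
    and "0 \<le> \<mu>" "0 < \<sigma>" "0 < \<theta>" "\<theta> < 1"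
  shows "\<exists>m. accepts f \<mu> x (\<theta> ^ m * \<sigma>)"
proof -
  obtain r where "r > 0" and fin: "\<And>y. dist y x < r \<Longrightarrow> \<bar>f y\<bar> \<noteq> \<infinity>"
    using assms(1) unfolding eventually_nhds_metric by blast
  define B where "B = norm (x - J f \<mu> x \<sigma>) / \<sigma>"
  show ?thesis
  proof (cases "B = 0")
    case True
    then have "J f \<mu> x \<sigma> = x" using \<open>0 < \<sigma>\<close> by (simp add: B_def)
    then have "accepts f \<mu> x (\<theta> ^ 0 * \<sigma>)" using fin[of x] \<open>r > 0\<close> by (intro acceptsI) auto
    then show ?thesis by blast
  next
    case False
    then have "B / 2 > 0" using \<open>0 < \<sigma>\<close> by (simp add: B_def)
    from has_derivative_remainder[OF der[unfolded gderiv_def] this]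
    obtain d where "d > 0" and rem: "\<And>h. norm h < d \<Longrightarrow>
        \<bar>real_of_ereal (f (x + h)) - real_of_ereal (f x) - h \<bullet> grad f x\<bar> \<le> B / 2 * norm h"
      by auto
    \<comment> \<open>The displacement for the step \<open>\<theta>\<^sup>m \<sigma>\<close> is at most \<open>\<theta>\<^sup>m C\<close>.\<close>
    define C where "C = \<sigma> * (norm (grad f x) + \<mu> * CARD('n))"
    have "C \<ge> 0" using \<open>0 < \<sigma>\<close> \<open>0 \<le> \<mu>\<close> by (simp add: C_def)
    have "min r d / (C + 1) > 0" using \<open>d > 0\<close> \<open>r > 0\<close> \<open>C \<ge> 0\<close> by simp
    from real_arch_pow_inv[OF this \<open>\<theta> < 1\<close>] obtain m where m: "\<theta> ^ m < min r d / (C + 1)" by blast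
    define a where "a = \<theta> ^ m * \<sigma>"
    have "a > 0" "a \<le> \<sigma>" using assms by (auto simp: a_def mult_left_le_one_le power_le_one)
    define h where "h = J f \<mu> x a - x"
    have "norm h \<le> a * (norm (grad f x) + \<mu> * CARD('n))"
      using J_displacement_le[OF \<open>a > 0\<close> \<open>0 \<le> \<mu>\<close>, of x f] by (simp add: h_def norm_minus_commute)
    also have "\<dots> = \<theta> ^ m * C" by (simp add: a_def C_def)
    also have "\<dots> \<le> \<theta> ^ m * (C + 1)" using \<open>0 < \<theta>\<close> by simp
    also have "\<dots> < min r d" using m \<open>C \<ge> 0\<close> by (simp add: pos_less_divide_eq)
    finally have small: "norm h < r" "norm h < d" by auto
    have "B \<le> norm h / a"
      using J_displacement_ratio_antimono[OF \<open>a > 0\<close> \<open>a \<le> \<sigma>\<close> \<open>0 \<le> \<mu>\<close>, of x f]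
      by (simp add: B_def h_def norm_minus_commute)
    then have "B / 2 * norm h \<le> norm h / a / 2 * norm h" by (intro mult_right_mono) auto
    also have "\<dots> = (norm h)\<^sup>2 / (2 * a)" by (simp add: power2_eq_square)
    finally have "real_of_ereal (f (x + h)) \<le> real_of_ereal (f x) + grad f x \<bullet> h + (norm h)\<^sup>2 / (2 * a)"
      using rem[OF small(2)] unfolding inner_commute[of h] by linarith
    then have "accepts f \<mu> x a"
      using fin[of x] fin[of "x + h"] small(1) \<open>r > 0\<close>
      by (intro acceptsI) (simp_all add: h_def dist_norm)
    then show ?thesis unfolding a_def by blast
  qed
qed

text \<open>The induction removes the first iteration of the loop, hence the arbitrary start value.\<close>

lemma while_geometric:
  fixes s :: real
  assumes "\<not> b (\<theta> ^ m * s)"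
  shows "\<exists>i. while b (\<lambda>a. \<theta> * a) s = \<theta> ^ i * s \<and> \<not> b (\<theta> ^ i * s) \<and> (\<forall>j<i. b (\<theta> ^ j * s))"
  using assms
proof (induction m arbitrary: s)
  case 0
  then show ?case by (intro exI[of _ 0]) (simp add: while_unfold)
next
  case (Suc m)
  show ?case
  proof (cases "b s")
    case False
    then show ?thesis by (intro exI[of _ 0]) (simp add: while_unfold)
  next
    case True
    from Suc.prems have "\<not> b (\<theta> ^ m * (\<theta> * s))" by (simp add: mult.left_commute mult.assoc)
    from Suc.IH[OF this] obtain i where i: "while b (\<lambda>a. \<theta> * a) (\<theta> * s) = \<theta> ^ i * (\<theta> * s)"
      "\<not> b (\<theta> ^ i * (\<theta> * s))" "\<forall>j<i. b (\<theta> ^ j * (\<theta> * s))" by blast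
    have "b (\<theta> ^ j * s)" if "j < Suc i" for j
      using that i(3) True by (cases j) (auto simp: mult.left_commute mult.assoc)
    with i(1,2) True show ?thesis
      by (intro exI[of _ "Suc i"]) (subst while_unfold, auto simp: mult.left_commute mult.assoc)
  qed
qed

lemma LS_result:
  assumes "accepts f \<mu> x (\<theta> ^ m * \<sigma>)"
  obtains i where "LS f \<mu> x \<sigma> \<theta> = \<theta> ^ i * \<sigma>" "accepts f \<mu> x (\<theta> ^ i * \<sigma>)"
    "\<And>j. j < i \<Longrightarrow> \<not> accepts f \<mu> x (\<theta> ^ j * \<sigma>)"
proof -
  let ?b = "\<lambda>\<alpha>. f (J f \<mu> x \<alpha>) > f x +
        ereal (grad f x \<bullet> (J f \<mu> x \<alpha> - x) + 1 / (2 * \<alpha>) * (norm (x - J f \<mu> x \<alpha>))\<^sup>2)"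
  have b: "?b \<alpha> \<longleftrightarrow> \<not> accepts f \<mu> x \<alpha>" for \<alpha> by (simp add: accepts_def not_le)
  with assms have "\<not> ?b (\<theta> ^ m * \<sigma>)" by blast
  from while_geometric[of ?b, OF this] obtain i where "LS f \<mu> x \<sigma> \<theta> = \<theta> ^ i * \<sigma>"
    and "\<not> ?b (\<theta> ^ i * \<sigma>)" "\<forall>j<i. ?b (\<theta> ^ j * \<sigma>)"
    unfolding LS_def by blast
  then show ?thesis unfolding b by (intro that) auto
qed

section \<open>One step of the method\<close>

text \<open>The part of both smoothness notions that a single step of the method uses.\<close>

definition smooth_point :: "(real^'n \<Rightarrow> ereal) \<Rightarrow> real^'n \<Rightarrow> bool" where
  "smooth_point f x \<longleftrightarrow>
     (\<forall>\<^sub>F y in nhds x. \<bar>f y\<bar> \<noteq> \<infinity>) \<and> GDERIV (real_of_ereal \<circ> f) x :> grad f x"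

text \<open>Coincides with \<^const>\<open>F1\<close> where \<open>f\<close> is finite, which covers all iterates and the limit.\<close>

definition real_F1 :: "(real^'n \<Rightarrow> ereal) \<Rightarrow> real \<Rightarrow> real^'n \<Rightarrow> real" where
  "real_F1 f \<mu> x = real_of_ereal (f x) + \<mu> * norm1 x"

lemma F1_eq_real_F1: "\<bar>f x\<bar> \<noteq> \<infinity> \<Longrightarrow> F1 f \<mu> x = ereal (real_F1 f \<mu> x)"
  by (cases "f x") (auto simp: F1_def real_F1_def)

lemma smooth_point_finite: "smooth_point f x \<Longrightarrow> \<bar>f x\<bar> \<noteq> \<infinity>"
  unfolding smooth_point_def by (auto dest: eventually_nhds_x_imp_x)

text \<open>Riesz representation of the Frechet derivative, with uniqueness to resolve the definite
  description in \<^const>\<open>grad\<close>.\<close>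

lemma GDERIV_grad:
  assumes "(real_of_ereal \<circ> f) differentiable (at x)"
  shows "GDERIV (real_of_ereal \<circ> f) x :> grad f x"
proof -
  obtain A where A: "((real_of_ereal \<circ> f) has_derivative A) (at x)"
    using assms unfolding differentiable_def by blast
  interpret A: bounded_linear A using A by (rule has_derivative_bounded_linear)
  have "A h = h \<bullet> (\<Sum>b\<in>Basis. A b *\<^sub>R b)" for h
  proof -
    have "A h = A (\<Sum>b\<in>Basis. (h \<bullet> b) *\<^sub>R b)" by (simp only: euclidean_representation)
    also have "\<dots> = (\<Sum>b\<in>Basis. (h \<bullet> b) * A b)" by (simp add: A.sum A.scaleR)
    also have "\<dots> = h \<bullet> (\<Sum>b\<in>Basis. A b *\<^sub>R b)"
      by (simp add: inner_sum_right mult.commute)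
    finally show ?thesis .
  qed
  then have "A = (\<lambda>h. h \<bullet> (\<Sum>b\<in>Basis. A b *\<^sub>R b))" by (rule ext)
  with A have ex: "GDERIV (real_of_ereal \<circ> f) x :> (\<Sum>b\<in>Basis. A b *\<^sub>R b)"
    unfolding gderiv_def by (rule has_derivative_eq_rhs)
  have unique: "D = E" if "GDERIV (real_of_ereal \<circ> f) x :> D" "GDERIV (real_of_ereal \<circ> f) x :> E" for D E
  proof -
    have "(\<lambda>h. h \<bullet> D) = (\<lambda>h. h \<bullet> E)" using that unfolding gderiv_def by (rule has_derivative_unique)
    then have "(D - E) \<bullet> D = (D - E) \<bullet> E" by (rule fun_cong)
    then have "(D - E) \<bullet> (D - E) = 0" by (simp add: inner_diff_right)
    then show "D = E" by simp
  qed
  show ?thesis unfolding grad_def by (rule theI[of "\<lambda>D. GDERIV (real_of_ereal \<circ> f) x :> D", OF ex]) (rule unique[OF _ ex])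
qed

lemma continuously_differentiable_imp_smooth_point:
  assumes "continuously_differentiable_at f x"
  shows "smooth_point f x"
proof -
  have ev: "\<forall>\<^sub>F y in nhds x. \<bar>f y\<bar> \<noteq> \<infinity> \<and> (real_of_ereal \<circ> f) differentiable (at y)"
    using assms by (simp add: continuously_differentiable_at_def)
  then have "\<forall>\<^sub>F y in nhds x. \<bar>f y\<bar> \<noteq> \<infinity>" by (rule eventually_mono) simp
  moreover have "(real_of_ereal \<circ> f) differentiable (at x)"
    using eventually_nhds_x_imp_x[OF ev] by simp
  ultimately show ?thesis unfolding smooth_point_def by (simp add: GDERIV_grad)
qed

lemma convex_gradient_inequality:
  assumes "proper f" "convex_fun f" and x: "smooth_point f x" and y: "f y < \<infinity>"
  shows "real_of_ereal (f x) + grad f x \<bullet> (y - x) \<le> real_of_ereal (f y)"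
proof -
  define d where "d = y - x"
  have "\<bar>f y\<bar> \<noteq> \<infinity>" using y \<open>proper f\<close> by (auto simp: proper_def)
  then obtain u v where u: "f x = ereal u" and v: "f y = ereal v"
    using smooth_point_finite[OF x] by (auto elim!: ereal_cases)
  have "real_of_ereal (f (x + t *\<^sub>R d)) \<le> u + t * (v - u)" if "0 < t" "t < 1" for t
  proof -
    have "x + t *\<^sub>R d = (1 - t) *\<^sub>R x + t *\<^sub>R y" by (simp add: d_def algebra_simps)
    then have pt: "f (x + t *\<^sub>R d) = f ((1 - t) *\<^sub>R x + t *\<^sub>R y)" by (rule arg_cong)
    have "f ((1 - t) *\<^sub>R x + t *\<^sub>R y) \<le> ereal (1 - t) * f x + ereal t * f y"
      using \<open>convex_fun f\<close> that by (simp add: convex_fun_def)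
    then have "f (x + t *\<^sub>R d) \<le> ereal (u + t * (v - u))" unfolding pt u v by (simp add: algebra_simps)
    moreover have "f (x + t *\<^sub>R d) \<noteq> -\<infinity>" using \<open>proper f\<close> by (simp add: proper_def)
    ultimately show ?thesis by (cases "f (x + t *\<^sub>R d)") auto
  qed
  then have "\<forall>\<^sub>F t in at_right 0. (real_of_ereal \<circ> f) (x + t *\<^sub>R d) \<le> (real_of_ereal \<circ> f) (x + 0 *\<^sub>R d) + t * (v - u)"
    unfolding eventually_at_right_field by (intro exI[of _ 1]) (simp add: u)
  moreover have "GDERIV (real_of_ereal \<circ> f) (x + 0 *\<^sub>R d) :> grad f x"
    using x by (simp add: smooth_point_def)
  ultimately have "grad f x \<bullet> d \<le> v - u"
    using derivative_le_right_slope gradient_along_line by fast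
  then show ?thesis by (simp add: u v d_def)
qed

lemma accepted_step_finite:
  assumes "proper f" "smooth_point f x" "accepts f \<mu> x \<alpha>"
  shows "\<bar>f (J f \<mu> x \<alpha>)\<bar> \<noteq> \<infinity>"
proof -
  obtain u where "f x = ereal u" using smooth_point_finite[OF assms(2)] by (auto elim!: ereal_cases)
  with assms(3) have "f (J f \<mu> x \<alpha>) \<noteq> \<infinity>" by (auto simp: accepts_def)
  with assms(1) show ?thesis by (auto simp: proper_def)
qed

text \<open>The basic estimate of the convergence analysis: with \<open>y\<close> a minimizer it makes the distance to \<open>y\<close>
  decrease, and with \<open>y = x\<close> it bounds the length of the step by the decrease of the objective.\<close>

lemma forward_backward_inequality:
  assumes f: "proper f" "convex_fun f" and x: "smooth_point f x" and y: "f y < \<infinity>"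
    and "0 < \<alpha>" "0 \<le> \<mu>" and acc: "accepts f \<mu> x \<alpha>"
  shows "2 * \<alpha> * (real_F1 f \<mu> (J f \<mu> x \<alpha>) - real_F1 f \<mu> y)
           \<le> (norm (x - y))\<^sup>2 - (norm (J f \<mu> x \<alpha> - y))\<^sup>2"
proof -
  define p where "p = J f \<mu> x \<alpha>"
  obtain u v where u: "f x = ereal u" and v: "f p = ereal v"
    using smooth_point_finite[OF x] accepted_step_finite[OF f(1) x acc]
    by (auto simp: p_def elim!: ereal_cases)
  have 1: "v \<le> u + grad f x \<bullet> (p - x) + (norm (x - p))\<^sup>2 / (2 * \<alpha>)"
    using acc by (simp add: accepts_def u v flip: p_def)
  have 2: "u + grad f x \<bullet> (y - x) \<le> real_of_ereal (f y)"
    using convex_gradient_inequality[OF f x y] by (simp add: u)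
  have "\<mu> * norm1 p + ((x - p) /\<^sub>R \<alpha> - grad f x) \<bullet> (y - p) \<le> \<mu> * norm1 y"
    using J_subgradient[OF \<open>0 < \<alpha>\<close> \<open>0 \<le> \<mu>\<close>, of x f] by (simp add: subdifferential_def p_def)
  then have 3: "\<mu> * norm1 p - \<mu> * norm1 y \<le> grad f x \<bullet> (y - p) - ((x - p) \<bullet> (y - p)) / \<alpha>"
    by (simp add: inner_diff_left divide_inverse mult.commute)
  have "real_F1 f \<mu> p - real_F1 f \<mu> y \<le> (norm (x - p))\<^sup>2 / (2 * \<alpha>) - ((x - p) \<bullet> (y - p)) / \<alpha>"
    using 1 2 3 unfolding real_F1_def v by (simp add: inner_diff_right)
  then have "2 * \<alpha> * (real_F1 f \<mu> p - real_F1 f \<mu> y)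
      \<le> 2 * \<alpha> * ((norm (x - p))\<^sup>2 / (2 * \<alpha>) - ((x - p) \<bullet> (y - p)) / \<alpha>)"
    using \<open>0 < \<alpha>\<close> by (intro mult_left_mono) auto
  also have "\<dots> = (norm (x - p))\<^sup>2 - 2 * ((x - p) \<bullet> (y - p))"
    using \<open>0 < \<alpha>\<close> by (simp add: field_simps)
  also have "\<dots> = (norm (x - y))\<^sup>2 - (norm (p - y))\<^sup>2"
    by (simp add: power2_norm_eq_inner inner_diff_left inner_diff_right inner_commute)
  finally show ?thesis by (simp add: p_def)
qed

text \<open>Fermat's rule.  Convexity of the norm replaces the difference quotient of the nonsmooth part by
  its value at \<open>y\<close>, and minimality bounds the derivative of \<open>f\<close> in the direction \<open>y - z\<close> from below.\<close>

lemma minimizer_subgradient: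
  fixes f :: "real^'n \<Rightarrow> ereal"
  assumes min: "z \<in> minimizers (F1 f \<mu>)" and "0 \<le> \<mu>" and z: "smooth_point f z"
  shows "- grad f z \<in> subdifferential (\<lambda>y. \<mu> * norm1 y) z"
  unfolding subdifferential_def mem_Collect_eq
proof
  fix y
  define d where "d = y - z"
  define C where "C = \<mu> * norm1 y - \<mu> * norm1 z"
  obtain r where "r > 0" and fin: "\<And>y. dist y z < r \<Longrightarrow> \<bar>f y\<bar> \<noteq> \<infinity>"
    using z unfolding smooth_point_def eventually_nhds_metric by blast
  have "- (real_of_ereal \<circ> f) (z + t *\<^sub>R d) \<le> - (real_of_ereal \<circ> f) (z + 0 *\<^sub>R d) + t * C"
    if t: "0 < t" "t < min 1 (r / (norm d + 1))" for t
  proof -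
    have "t * norm d \<le> t * (norm d + 1)" using t by simp
    also have "\<dots> < r" using t by (simp add: pos_less_divide_eq add_nonneg_pos)
    finally have "\<bar>f (z + t *\<^sub>R d)\<bar> \<noteq> \<infinity>" using t by (intro fin) (simp add: dist_norm)
    moreover have "F1 f \<mu> z \<le> F1 f \<mu> (z + t *\<^sub>R d)" using min by (simp add: minimizers_def)
    ultimately have "real_F1 f \<mu> z \<le> real_F1 f \<mu> (z + t *\<^sub>R d)"
      by (simp add: F1_eq_real_F1 smooth_point_finite[OF z])
    moreover have "\<mu> * norm1 (z + t *\<^sub>R d) \<le> \<mu> * (norm1 z + t * (norm1 y - norm1 z))"
      unfolding d_def using t \<open>0 \<le> \<mu>\<close> by (intro mult_left_mono norm1_convex) auto
    ultimately show ?thesis by (simp add: real_F1_def C_def algebra_simps)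
  qed
  moreover have "0 < min 1 (r / (norm d + 1))" using \<open>r > 0\<close> by (simp add: add_nonneg_pos)
  ultimately have "\<forall>\<^sub>F t in at_right 0.
      - (real_of_ereal \<circ> f) (z + t *\<^sub>R d) \<le> - (real_of_ereal \<circ> f) (z + 0 *\<^sub>R d) + t * C"
    unfolding eventually_at_right_field by blast
  moreover have "GDERIV (real_of_ereal \<circ> f) (z + 0 *\<^sub>R d) :> grad f z"
    using z by (simp add: smooth_point_def)
  from DERIV_minus[OF gradient_along_line[OF this]]
  have "((\<lambda>t. - (real_of_ereal \<circ> f) (z + t *\<^sub>R d)) has_real_derivative - (grad f z \<bullet> d)) (at 0)" .
  ultimately have "- (grad f z \<bullet> d) \<le> C" using derivative_le_right_slope by fast
  then show "\<mu> * norm1 z + - grad f z \<bullet> (y - z) \<le> \<mu> * norm1 y" by (simp add: C_def d_def)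
qed

text \<open>The point \<open>z\<close> is a fixed point of the step and the proximal map is nonexpansive.  The bound keeps all
  trial points of the line search, not only the accepted one, close to \<open>z\<close>.\<close>

lemma J_dist_minimizer_le:
  fixes x :: "real^'n"
  assumes "- grad f z \<in> subdifferential (\<lambda>y. \<mu> * norm1 y) z" and "0 < \<alpha>" "0 \<le> \<mu>"
  shows "norm (J f \<mu> x \<alpha> - z) \<le> norm (x - z) + \<alpha> * norm (grad f x - grad f z)"
proof -
  define p where "p = J f \<mu> x \<alpha>"
  have "0 \<le> \<alpha> * (((x - p) /\<^sub>R \<alpha> - grad f x - - grad f z) \<bullet> (p - z))"
    using subdifferential_monotone[OF J_subgradient[OF assms(2,3), of x f] assms(1)] \<open>0 < \<alpha>\<close>
    by (simp add: p_def)
  also have "\<dots> = (x - z - \<alpha> *\<^sub>R (grad f x - grad f z)) \<bullet> (p - z) - (norm (p - z))\<^sup>2"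
  proof -
    have "\<alpha> * (((x - p) /\<^sub>R \<alpha> - grad f x - - grad f z) \<bullet> (p - z))
        = (\<alpha> *\<^sub>R ((x - p) /\<^sub>R \<alpha> - grad f x - - grad f z)) \<bullet> (p - z)" by simp
    also have "\<alpha> *\<^sub>R ((x - p) /\<^sub>R \<alpha> - grad f x - - grad f z)
        = (x - z - \<alpha> *\<^sub>R (grad f x - grad f z)) - (p - z)"
      using \<open>0 < \<alpha>\<close> by (simp add: scaleR_diff_right scaleR_add_right)
    finally show ?thesis by (simp only: power2_norm_eq_inner inner_diff_left)
  qed
  finally have "norm (p - z) * norm (p - z) \<le> norm (x - z - \<alpha> *\<^sub>R (grad f x - grad f z)) * norm (p - z)"
    using norm_cauchy_schwarz[of "x - z - \<alpha> *\<^sub>R (grad f x - grad f z)" "p - z"]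
    by (simp add: power2_eq_square)
  then have "norm (p - z) \<le> norm (x - z - \<alpha> *\<^sub>R (grad f x - grad f z))" 
    by (cases "p = z") auto
  also have "\<dots> \<le> norm (x - z) + \<alpha> * norm (grad f x - grad f z)"
    using norm_triangle_ineq4[of "x - z" "\<alpha> *\<^sub>R (grad f x - grad f z)"] \<open>0 < \<alpha>\<close> by simp
  finally show ?thesis by (simp add: p_def)
qed

lemma standing_assumptions_smooth_point:
  assumes "standing_assumptions f \<mu>" and "x \<in> interior (effective_domain f)"
  shows "smooth_point f x"
  using assms unfolding standing_assumptions_def
  by (intro continuously_differentiable_imp_smooth_point) auto

lemma standing_assumptions_sublevel:
  assumes "standing_assumptions f \<mu>" and "x \<in> interior (effective_domain f)" "F1 f \<mu> y \<le> F1 f \<mu> x"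
  shows "y \<in> interior (effective_domain f)"
  using assms unfolding standing_assumptions_def by blast

text \<open>Termination of the line search, positivity of the step sizes and membership of the iterates in the
  interior of the domain depend on each other, so they are proved by one induction.  The number \<open>prev k\<close> is
  the step size at which the search in iteration \<open>k\<close> starts.\<close>

lemma FBS_step:
  assumes st: "standing_assumptions f \<mu>" and "0 < \<mu>" and fbs: "FBS f \<mu> \<sigma> \<theta> x \<alpha>"
  defines "prev \<equiv> \<lambda>k. if k = 0 then \<sigma> else \<alpha> (k - 1)"
  shows "x k \<in> interior (effective_domain f) \<and> 0 < prev k \<and> prev k \<le> \<sigma> \<and> accepts f \<mu> (x k) (\<alpha> k) \<and>
    (\<exists>i. \<alpha> k = \<theta> ^ i * prev k \<and> (\<forall>j<i. \<not> accepts f \<mu> (x k) (\<theta> ^ j * prev k)))"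
proof (induction k)
  have \<theta>: "0 < \<theta>" "\<theta> < 1" "0 < \<sigma>" and x0: "x 0 \<in> interior (effective_domain f)"
    and step: "\<And>k. \<alpha> k = LS f \<mu> (x k) (prev k) \<theta>" "\<And>k. x (Suc k) = J f \<mu> (x k) (\<alpha> k)"
    using fbs by (auto simp: FBS_def prev_def)
  have search: "accepts f \<mu> (x k) (\<alpha> k) \<and>
      (\<exists>i. \<alpha> k = \<theta> ^ i * prev k \<and> (\<forall>j<i. \<not> accepts f \<mu> (x k) (\<theta> ^ j * prev k)))"
    if k: "x k \<in> interior (effective_domain f)" "0 < prev k" for k
  proof -
    have "smooth_point f (x k)" by (rule standing_assumptions_smooth_point[OF st k(1)])
    then obtain m where "accepts f \<mu> (x k) (\<theta> ^ m * prev k)"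
      using small_steps_accepted[of f "x k" \<mu> "prev k" \<theta>] k(2) \<theta> \<open>0 < \<mu>\<close>
      unfolding smooth_point_def by auto
    from LS_result[OF this] show ?thesis unfolding step(1)[of k] by metis
  qed
  {
    case 0
    have "prev 0 = \<sigma>" by (simp add: prev_def)
    then show ?case using search[of 0] x0 \<theta> by simp
  next
    case (Suc k)
    have xk: "x k \<in> interior (effective_domain f)" and acc: "accepts f \<mu> (x k) (\<alpha> k)" using Suc by auto
    have sm: "smooth_point f (x k)" by (rule standing_assumptions_smooth_point[OF st xk])
    obtain i where i: "\<alpha> k = \<theta> ^ i * prev k" using Suc by blast
    have prev: "0 < prev k" "prev k \<le> \<sigma>" using Suc by auto
    have "\<theta> ^ i * prev k \<le> prev k"
      using prev \<theta> by (intro mult_left_le_one_le) (auto simp: power_le_one)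
    then have "\<theta> ^ i * prev k \<le> \<sigma>" using prev(2) by (rule order_trans)
    with i prev \<theta> have \<alpha>: "0 < \<alpha> k" "\<alpha> k \<le> \<sigma>" by auto
    have pf: "proper f" "convex_fun f" using st by (auto simp: standing_assumptions_def)
    have fin: "\<bar>f (x k)\<bar> \<noteq> \<infinity>" "\<bar>f (x (Suc k))\<bar> \<noteq> \<infinity>"
      using smooth_point_finite[OF sm] accepted_step_finite[OF pf(1) sm acc] by (auto simp: step(2))
    then have "f (x k) < \<infinity>" by auto
    from forward_backward_inequality[OF pf sm this \<alpha>(1) _ acc]
    have "2 * \<alpha> k * (real_F1 f \<mu> (x (Suc k)) - real_F1 f \<mu> (x k)) \<le> - (norm (x (Suc k) - x k))\<^sup>2"
      using \<open>0 < \<mu>\<close> by (simp add: step(2))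
    then have "2 * \<alpha> k * (real_F1 f \<mu> (x (Suc k)) - real_F1 f \<mu> (x k)) \<le> 0"
      by (rule order_trans) simp
    then have "real_F1 f \<mu> (x (Suc k)) \<le> real_F1 f \<mu> (x k)" using \<alpha>(1) by (simp add: mult_le_0_iff)
    then have "F1 f \<mu> (x (Suc k)) \<le> F1 f \<mu> (x k)" using fin by (simp add: F1_eq_real_F1)
    then have "x (Suc k) \<in> interior (effective_domain f)"
      by (rule standing_assumptions_sublevel[OF st xk])
    moreover have "prev (Suc k) = \<alpha> k" by (simp add: prev_def)
    ultimately show ?case using search[of "Suc k"] \<alpha> by auto
  }
qed

section \<open>Quadratic growth at the limit\<close>

text \<open>The subgradient inequality at \<open>z + s e\<^sub>j\<close>, where the other coordinates cancel.  Optimality thus holds in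
  each coordinate separately.\<close>

lemma kink_weight_nonneg:
  fixes z :: "real^'n"
  assumes opt: "- D \<in> subdifferential (\<lambda>y. \<mu> * norm1 y) z"
  shows "0 \<le> D $ j * s + \<mu> * (\<bar>z $ j + s\<bar> - \<bar>z $ j\<bar>)"
proof -
  have "norm1 (z + axis j s) - norm1 z = (\<Sum>i\<in>UNIV. \<bar>(z + axis j s) $ i\<bar> - \<bar>z $ i\<bar>)"
    by (simp add: norm1_def sum_subtractf)
  also have "\<dots> = (\<Sum>i\<in>UNIV. if i = j then \<bar>z $ j + s\<bar> - \<bar>z $ j\<bar> else 0)"
    by (rule sum.cong) (auto simp: axis_def)
  finally have "norm1 (z + axis j s) = norm1 z + (\<bar>z $ j + s\<bar> - \<bar>z $ j\<bar>)" by simp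
  then have "\<mu> * norm1 (z + axis j s) = \<mu> * norm1 z + \<mu> * (\<bar>z $ j + s\<bar> - \<bar>z $ j\<bar>)"
    by (simp add: distrib_left)
  moreover have "\<mu> * norm1 z + - D \<bullet> (z + axis j s - z) \<le> \<mu> * norm1 (z + axis j s)"
    using opt by (simp only: subdifferential_def mem_Collect_eq)
  ultimately show ?thesis by (simp add: inner_axis mult.commute)
qed

text \<open>The cone consists of the directions in which the objective does not grow at first order.  For a
  coordinate with \<open>|\<nabla>f(z)\<^sub>j| < \<mu>\<close> the optimality condition forces \<open>z\<^sub>j = 0\<close>, and first-order growth is
  then at least \<open>(\<mu> - |\<nabla>f(z)\<^sub>j|) |u\<^sub>j|\<close>.\<close>

lemma critical_direction_in_cone:
  fixes z :: "real^'n"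
  assumes opt: "- grad f z \<in> subdifferential (\<lambda>y. \<mu> * norm1 y) z" and "0 < \<mu>"
    and crit: "\<And>j. z $ j = 0 \<Longrightarrow> grad f z $ j * u $ j + \<mu> * \<bar>u $ j\<bar> \<le> 0"
  shows "u \<in> cone_U f \<mu> z"
proof -
  have "u $ j = 0" if j: "j \<notin> index_E f \<mu> z" for j
  proof -
    have z: "z $ j = 0"
    proof (rule ccontr)
      assume "z $ j \<noteq> 0"
      have "\<bar>z $ j + z $ j\<bar> - \<bar>z $ j\<bar> = \<bar>z $ j\<bar>" by (simp add: abs_if)
      then have eq: "grad f z $ j * z $ j = - (\<mu> * \<bar>z $ j\<bar>)"
        using kink_weight_nonneg[OF opt, of j "z $ j"] kink_weight_nonneg[OF opt, of j "- z $ j"] by simp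
      have "\<bar>grad f z $ j * z $ j\<bar> = \<mu> * \<bar>z $ j\<bar>"
        unfolding eq using \<open>0 < \<mu>\<close> by (simp add: abs_mult)
      then have "\<bar>grad f z $ j\<bar> * \<bar>z $ j\<bar> = \<mu> * \<bar>z $ j\<bar>" by (simp only: abs_mult)
      with \<open>z $ j \<noteq> 0\<close> j show False by (simp add: index_E_def)
    qed
    have "\<bar>grad f z $ j\<bar> \<le> \<mu>"
      using kink_weight_nonneg[OF opt, of j 1] kink_weight_nonneg[OF opt, of j "-1"] by (simp add: z)
    with j have "\<bar>grad f z $ j\<bar> < \<mu>" by (simp add: index_E_def)
    moreover have "\<mu> * \<bar>u $ j\<bar> \<le> \<bar>grad f z $ j\<bar> * \<bar>u $ j\<bar>"
      using crit[OF z] abs_ge_minus_self[of "grad f z $ j * u $ j"] by (simp add: abs_mult)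
    ultimately show "u $ j = 0" by (metis abs_le_zero_iff mult_le_cancel_right not_le)
  qed
  moreover have "u $ j * grad f z $ j \<le> 0" if "j \<in> index_K0 f \<mu> z" for j
  proof -
    have "0 \<le> \<mu> * \<bar>u $ j\<bar>" using \<open>0 < \<mu>\<close> by simp
    with crit[of j] that show ?thesis by (simp add: index_K0_def mult.commute)
  qed
  ultimately show ?thesis by (simp add: cone_U_def)
qed

lemma hessian_E_quadratic_form:
  assumes "u \<in> cone_U f \<mu> z"
  shows "(hessian_E f \<mu> z *v u) \<bullet> u = (hessian f z *v u) \<bullet> u"
proof -
  have u: "u $ j = 0" if "j \<notin> index_E f \<mu> z" for j using assms that by (simp add: cone_U_def)
  have "(hessian_E f \<mu> z *v u) $ i * u $ i = (hessian f z *v u) $ i * u $ i" for i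
  proof (cases "i \<in> index_E f \<mu> z")
    case True
    have "(hessian_E f \<mu> z *v u) $ i = (hessian f z *v u) $ i"
      unfolding matrix_vector_mult_def hessian_E_def using True u by (auto intro!: sum.cong)
    then show ?thesis by simp
  qed (simp add: u)
  then show ?thesis by (simp only: inner_vec_def inner_real_def)
qed

text \<open>By contradiction: normalised differences of points \<open>y\<^sub>n \<longlonglongrightarrow> z\<close> that violate the bound have a limit
  direction \<open>u\<close>.  The increment of the objective is the second-order remainder of \<open>f\<close>, which is of order
  \<open>|y\<^sub>n - z|\<^sup>2\<close>, plus the nonnegative weights of \<open>kink_weight_nonneg\<close>.  The weights of coordinates at a
  kink are homogeneous of degree one, so the violated bound forces them to vanish in the limit, which
  puts \<open>u\<close> in the cone.  Dropping the weights then leaves \<open>(H u) \<bullet> u \<le> \<kappa>\<close>, against the hypothesis.\<close>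

lemma quadratic_growth:
  fixes f :: "real^'n \<Rightarrow> ereal"
  assumes grad: "\<forall>\<^sub>F y in nhds z. GDERIV (real_of_ereal \<circ> f) y :> grad f y"
    and hess: "(grad f has_derivative (*v) (hessian f z)) (at z)"
    and opt: "- grad f z \<in> subdifferential (\<lambda>y. \<mu> * norm1 y) z" and "0 < \<mu>"
    and pos: "\<And>u. u \<in> cone_U f \<mu> z \<Longrightarrow> u \<noteq> 0 \<Longrightarrow> \<kappa> * (norm u)\<^sup>2 < (hessian_E f \<mu> z *v u) \<bullet> u"
  shows "\<forall>\<^sub>F y in nhds z. \<kappa> / 2 * (norm (y - z))\<^sup>2 \<le> real_F1 f \<mu> y - real_F1 f \<mu> z"
proof (rule ccontr)
  define H where "H = hessian f z"
  \<comment> \<open>The increment of the nonsmooth part together with the linear part of \<open>f\<close>, coordinate by coordinate.\<close>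
  define w where "w = (\<lambda>h j. grad f z $ j * h $ j + \<mu> * (\<bar>z $ j + h $ j\<bar> - \<bar>z $ j\<bar>))"
  have w_nonneg: "0 \<le> w h j" for h j unfolding w_def by (rule kink_weight_nonneg[OF opt])
  define \<phi> where "\<phi> = real_of_ereal \<circ> f"
  define rem where "rem = (\<lambda>h. \<phi> (z + h) - \<phi> z - grad f z \<bullet> h)"
  have split: "real_F1 f \<mu> (z + h) - real_F1 f \<mu> z = rem h + (\<Sum>j\<in>UNIV. w h j)" for h
    by (simp add: rem_def \<phi>_def real_F1_def w_def norm1_def inner_vec_def sum.distrib sum_subtractf
        sum_distrib_left algebra_simps)
  assume "\<not> (\<forall>\<^sub>F y in nhds z. \<kappa> / 2 * (norm (y - z))\<^sup>2 \<le> real_F1 f \<mu> y - real_F1 f \<mu> z)"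
  then have *: "\<exists>y. dist y z < d \<and> real_F1 f \<mu> y - real_F1 f \<mu> z < \<kappa> / 2 * (norm (y - z))\<^sup>2"
    if "d > 0" for d
    using that unfolding eventually_nhds_metric by (auto simp: not_le)
  have "\<exists>y. dist y z < inverse (Suc n) \<and> real_F1 f \<mu> y - real_F1 f \<mu> z < \<kappa> / 2 * (norm (y - z))\<^sup>2" for n
    by (rule *) simp
  then obtain y where y: "\<And>n. dist (y n) z < inverse (Suc n)"
    and viol: "\<And>n. real_F1 f \<mu> (y n) - real_F1 f \<mu> z < \<kappa> / 2 * (norm (y n - z))\<^sup>2" by metis
  define h where "h = (\<lambda>n. y n - z)"
  have h: "norm (h n) < inverse (Suc n)" for n using y[of n] by (simp add: h_def dist_norm)
  have viol': "rem (h n) + (\<Sum>j\<in>UNIV. w (h n) j) < \<kappa> / 2 * (norm (h n))\<^sup>2" for n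
    using viol[of n] split[of "h n"] by (simp add: h_def)
  have nz: "h n \<noteq> 0" for n using viol[of n] by (auto simp: h_def)
  have seq: "\<forall>n. h n /\<^sub>R norm (h n) \<in> sphere 0 1" using nz by simp
  obtain u \<rho> where u: "u \<in> sphere 0 1" and \<rho>: "strict_mono \<rho>"
    and lim: "((\<lambda>n. h n /\<^sub>R norm (h n)) \<circ> \<rho>) \<longlonglongrightarrow> u"
    by (rule seq_compactE[OF compact_imp_seq_compact[OF compact_sphere] seq])
  define t where "t = (\<lambda>n. norm (h (\<rho> n)))"
  define v where "v = (\<lambda>n. h (\<rho> n) /\<^sub>R t n)"
  have v: "v \<longlonglongrightarrow> u" using lim by (simp add: v_def t_def o_def)
  have t_pos: "0 < t n" for n using nz by (simp add: t_def)
  have hv: "h (\<rho> n) = t n *\<^sub>R v n" for n using t_pos[of n] by (simp add: v_def)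
  have "\<forall>\<^sub>F n in sequentially. norm (h n) \<le> inverse (real (Suc n))"
    using less_imp_le[OF h] by (rule eventuallyI)
  from Lim_null_comparison[OF this LIMSEQ_inverse_real_of_nat] have "h \<longlonglongrightarrow> 0" .
  from tendsto_norm_zero[OF LIMSEQ_subseq_LIMSEQ[OF this \<rho>]] have t0: "t \<longlonglongrightarrow> 0"
    by (simp add: t_def o_def)
  have quad: "(\<lambda>n. (H *v v n) \<bullet> v n) \<longlonglongrightarrow> (H *v u) \<bullet> u"
    by (intro tendsto_inner bounded_linear.tendsto[OF matrix_vector_mul_bounded_linear] v)
  define R where "R = (\<lambda>n. rem (h (\<rho> n)) / (t n)\<^sup>2)"
  have "(\<lambda>n. R n - (H *v v n) \<bullet> v n / 2) \<longlonglongrightarrow> 0"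
  proof (rule LIMSEQ_I)
    fix e :: real assume "e > 0"
    then have "e / 2 > 0" by simp
    from second_order_expansion[OF grad hess this] obtain d where "d > 0" and
      ex: "\<And>h. norm h < d \<Longrightarrow> \<bar>\<phi> (z + h) - \<phi> z - grad f z \<bullet> h - ((H *v h) \<bullet> h) / 2\<bar> \<le> e / 2 * (norm h)\<^sup>2"
      unfolding H_def \<phi>_def by blast
    obtain N where N: "\<And>n. n \<ge> N \<Longrightarrow> t n < d"
      using order_tendstoD(2)[OF t0 \<open>d > 0\<close>] unfolding eventually_sequentially by blast
    have "norm (R n - (H *v v n) \<bullet> v n / 2 - 0) < e" if "n \<ge> N" for n
    proof -
      have "(H *v h (\<rho> n)) \<bullet> h (\<rho> n) = (t n)\<^sup>2 * ((H *v v n) \<bullet> v n)"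
        by (simp add: hv matrix_vector_mult_scaleR power2_eq_square)
      then have "\<bar>rem (h (\<rho> n)) - (t n)\<^sup>2 * ((H *v v n) \<bullet> v n / 2)\<bar> \<le> e / 2 * (t n)\<^sup>2"
        using ex[of "h (\<rho> n)"] N[OF that] by (simp add: rem_def t_def)
      also have "rem (h (\<rho> n)) = (t n)\<^sup>2 * R n" using t_pos[of n] by (simp add: R_def)
      also have "(t n)\<^sup>2 * R n - (t n)\<^sup>2 * ((H *v v n) \<bullet> v n / 2) = (t n)\<^sup>2 * (R n - (H *v v n) \<bullet> v n / 2)"
        by (simp only: right_diff_distrib)
      finally have "\<bar>R n - (H *v v n) \<bullet> v n / 2\<bar> * (t n)\<^sup>2 \<le> e / 2 * (t n)\<^sup>2"
        by (simp only: abs_mult abs_power2 mult.commute)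
      then have "\<bar>R n - (H *v v n) \<bullet> v n / 2\<bar> \<le> e / 2" using t_pos[of n] by simp
      with \<open>e > 0\<close> show ?thesis by simp
    qed
    then show "\<exists>N. \<forall>n\<ge>N. norm (R n - (H *v v n) \<bullet> v n / 2 - 0) < e" by blast
  qed
  from tendsto_add[OF this tendsto_divide[OF quad tendsto_const[of 2]]]
  have R: "R \<longlonglongrightarrow> (H *v u) \<bullet> u / 2" by simp
  have R_viol: "R n + (\<Sum>j\<in>UNIV. w (h (\<rho> n)) j) / (t n)\<^sup>2 < \<kappa> / 2" for n
    using viol'[of "\<rho> n"] t_pos[of n] by (simp add: R_def t_def pos_divide_less_eq flip: add_divide_distrib)
  have cone: "u \<in> cone_U f \<mu> z"
  proof (rule critical_direction_in_cone[OF opt \<open>0 < \<mu>\<close>])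
    fix j assume j: "z $ j = 0"
    have "grad f z $ j * v n $ j + \<mu> * \<bar>v n $ j\<bar> \<le> t n * (\<kappa> / 2 - R n)" for n
    proof -
      have "w (h (\<rho> n)) j \<le> (\<Sum>j\<in>UNIV. w (h (\<rho> n)) j)"
        by (intro member_le_sum) (auto simp: w_nonneg)
      then have "w (h (\<rho> n)) j / (t n)\<^sup>2 \<le> (\<Sum>j\<in>UNIV. w (h (\<rho> n)) j) / (t n)\<^sup>2"
        by (rule divide_right_mono) simp
      then have "w (h (\<rho> n)) j / (t n)\<^sup>2 \<le> \<kappa> / 2 - R n" using R_viol[of n] by linarith
      moreover have "w (h (\<rho> n)) j = t n * (grad f z $ j * v n $ j + \<mu> * \<bar>v n $ j\<bar>)"
        using t_pos[of n] by (simp add: w_def j hv abs_mult algebra_simps)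
      ultimately have "(grad f z $ j * v n $ j + \<mu> * \<bar>v n $ j\<bar>) / t n \<le> \<kappa> / 2 - R n"
        using t_pos[of n] by (simp add: power2_eq_square)
      then show ?thesis using t_pos[of n] by (simp add: pos_divide_le_eq mult.commute)
    qed
    moreover have "(\<lambda>n. grad f z $ j * v n $ j + \<mu> * \<bar>v n $ j\<bar>) \<longlonglongrightarrow> grad f z $ j * u $ j + \<mu> * \<bar>u $ j\<bar>"
      by (intro tendsto_intros v)
    moreover have "(\<lambda>n. t n * (\<kappa> / 2 - R n)) \<longlonglongrightarrow> 0 * (\<kappa> / 2 - (H *v u) \<bullet> u / 2)"
      by (intro tendsto_intros t0 R)
    ultimately show "grad f z $ j * u $ j + \<mu> * \<bar>u $ j\<bar> \<le> 0"
      by (intro LIMSEQ_le[of _ _ _ "0 :: real"]) auto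
  qed
  have "u \<noteq> 0" "norm u = 1" using u by auto
  with cone have "\<kappa> < (H *v u) \<bullet> u"
    using pos[of u] hessian_E_quadratic_form[OF cone] by (simp add: H_def)
  have "R n \<le> \<kappa> / 2" for n
  proof -
    have "0 \<le> (\<Sum>j\<in>UNIV. w (h (\<rho> n)) j) / (t n)\<^sup>2" by (intro divide_nonneg_nonneg sum_nonneg w_nonneg) auto
    with R_viol[of n] show ?thesis by linarith
  qed
  then have "(H *v u) \<bullet> u / 2 \<le> \<kappa> / 2" by (intro LIMSEQ_le_const2[OF R]) auto
  with \<open>\<kappa> < (H *v u) \<bullet> u\<close> show False by simp
qed

lemma growth_const_less:
  assumes "ereal \<kappa> < growth_const f \<mu> z" and "u \<in> cone_U f \<mu> z" "u \<noteq> 0"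
  shows "\<kappa> * (norm u)\<^sup>2 < (hessian_E f \<mu> z *v u) \<bullet> u"
  using less_INF_D[OF assms(1)[unfolded growth_const_def] assms(2)] assms(3)
  by (simp add: pos_less_divide_eq)

text \<open>Compactness of the unit vectors in the cone turns pointwise positivity into a positive constant.  If
  there are none, any constant serves.\<close>

lemma uniform_growth_exists:
  fixes z :: "real^'n"
  assumes "\<forall>u \<in> cone_U f \<mu> z - {0}. (hessian_E f \<mu> z *v u) \<bullet> u > 0"
  obtains \<kappa> where "0 < \<kappa>" "\<And>u. u \<in> cone_U f \<mu> z \<Longrightarrow> u \<noteq> 0 \<Longrightarrow> \<kappa> * (norm u)\<^sup>2 < (hessian_E f \<mu> z *v u) \<bullet> u"
proof -
  define A where "A = hessian_E f \<mu> z"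
  define S where "S = cone_U f \<mu> z \<inter> sphere 0 1"
  have "cone_U f \<mu> z = (\<Inter>j\<in>- index_E f \<mu> z. {u. u $ j = 0}) \<inter>
      (\<Inter>j\<in>index_K0 f \<mu> z. {u. u $ j * grad f z $ j \<le> 0})"
    by (auto simp: cone_U_def)
  then have "closed (cone_U f \<mu> z)"
    by (auto intro!: closed_Collect_eq closed_Collect_le continuous_intros)
  then have "compact S" unfolding S_def by (rule closed_Int_compact) simp
  have scale: "u /\<^sub>R norm u \<in> S" if "u \<in> cone_U f \<mu> z" "u \<noteq> 0" for u
    using that by (auto simp: S_def cone_U_def mult.assoc mult_le_0_iff zero_le_mult_iff)
  have cont: "continuous_on S (\<lambda>u. (A *v u) \<bullet> u)"
    by (intro continuous_intros linear_continuous_on matrix_vector_mul_bounded_linear)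
  obtain m where "0 < m" and m: "\<And>u. u \<in> S \<Longrightarrow> m \<le> (A *v u) \<bullet> u"
  proof (cases "S = {}")
    case True
    then show ?thesis using that[of 1] by simp
  next
    case False
    from continuous_attains_inf[OF \<open>compact S\<close> this cont] obtain w
      where w: "w \<in> S" "\<And>u. u \<in> S \<Longrightarrow> (A *v w) \<bullet> w \<le> (A *v u) \<bullet> u" by blast
    moreover have "w \<in> cone_U f \<mu> z - {0}" using w(1) by (auto simp: S_def)
    ultimately show ?thesis using that[of "(A *v w) \<bullet> w"] assms by (simp add: A_def)
  qed
  show ?thesis
  proof (rule that[of "m / 2"])
    show "0 < m / 2" using \<open>0 < m\<close> by simp
    fix u assume u: "u \<in> cone_U f \<mu> z" "u \<noteq> 0"
    have "m \<le> (A *v (u /\<^sub>R norm u)) \<bullet> (u /\<^sub>R norm u)" by (rule m[OF scale[OF u]])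
    also have "\<dots> = (A *v u) \<bullet> u / (norm u)\<^sup>2"
      by (simp add: matrix_vector_mult_scaleR power2_eq_square divide_simps)
    finally have "m * (norm u)\<^sup>2 \<le> (A *v u) \<bullet> u" using u(2) by (simp add: pos_le_divide_eq)
    moreover have "0 < m * (norm u)\<^sup>2" using u(2) \<open>0 < m\<close> by simp
    ultimately show "m / 2 * (norm u)\<^sup>2 < (hessian_E f \<mu> z *v u) \<bullet> u" by (simp add: A_def)
  qed
qed

section \<open>Step sizes near the limit\<close>

lemma C2_aroundE:
  assumes "C2_around f z"
  obtains V where "open V" "z \<in> V" "continuous_on V (hessian f)"
    "\<And>y. y \<in> V \<Longrightarrow> smooth_point f y"
    "\<And>y. y \<in> V \<Longrightarrow> (grad f has_derivative (*v) (hessian f y)) (at y)"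
proof -
  from assms[unfolded C2_around_def] obtain V where V: "open V" "z \<in> V" "continuous_on V (hessian f)"
    and f: "\<forall>y\<in>V. \<bar>f y\<bar> \<noteq> \<infinity> \<and> (real_of_ereal \<circ> f) differentiable (at y) \<and> grad f differentiable (at y)"
    by (elim exE conjE)
  show ?thesis
  proof (rule that[OF V])
    fix y assume "y \<in> V"
    with f have y: "(real_of_ereal \<circ> f) differentiable (at y)" "grad f differentiable (at y)" by blast+
    have "\<forall>\<^sub>F y in nhds y. y \<in> V" by (rule eventually_nhds_in_open[OF \<open>open V\<close> \<open>y \<in> V\<close>])
    then have "\<forall>\<^sub>F y in nhds y. \<bar>f y\<bar> \<noteq> \<infinity>" by (rule eventually_mono) (drule bspec[OF f], elim conjE, assumption)
    with GDERIV_grad[OF y(1)] show "smooth_point f y" unfolding smooth_point_def by blast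
    from y(2) show "(grad f has_derivative (*v) (hessian f y)) (at y)"
      unfolding hessian_def by (rule jacobian_works[THEN iffD1])
  qed
qed

lemma C2_around_grad:
  assumes "C2_around f z"
  shows "\<forall>\<^sub>F y in nhds z. GDERIV (real_of_ereal \<circ> f) y :> grad f y"
    and "(grad f has_derivative (*v) (hessian f z)) (at z)"
proof -
  obtain V where V: "open V" "z \<in> V" "\<And>y. y \<in> V \<Longrightarrow> smooth_point f y"
    "\<And>y. y \<in> V \<Longrightarrow> (grad f has_derivative (*v) (hessian f y)) (at y)"
    using C2_aroundE[OF assms] by metis
  show "\<forall>\<^sub>F y in nhds z. GDERIV (real_of_ereal \<circ> f) y :> grad f y"
    using eventually_nhds_in_open[OF V(1,2)] V(3) by (auto simp: smooth_point_def elim: eventually_mono)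
  show "(grad f has_derivative (*v) (hessian f z)) (at z)" by (rule V(4)[OF V(2)])
qed

lemma hessian_symmetric:
  assumes "C2_around f z"
  shows "transpose (hessian f z) = hessian f z"
proof -
  have "hessian f z $ j $ i = hessian f z $ i $ j" for i j
  proof -
    have entry: "(hessian f z *v axis i 1) \<bullet> axis j 1 = hessian f z $ j $ i" for i j
      by (simp add: matrix_vector_mult_basis inner_axis column_def)
    show ?thesis
      using derivative_of_gradient_symmetric[OF C2_around_grad[OF assms], of "axis i 1" "axis j 1"]
      unfolding entry .
  qed
  then show ?thesis unfolding transpose_def vec_eq_iff by simp
qed

text \<open>Continuity of the Hessian extends the bound from \<open>z\<close> to a ball, at the price of replacing the largest
  eigenvalue by a larger number.\<close>

lemma hessian_bounded_near:
  fixes f :: "real^'n \<Rightarrow> ereal"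
  assumes C2: "C2_around f z" and L: "max_eigenvalue (hessian f z) < L"
  obtains r where "0 < r" "\<And>y. y \<in> ball z r \<Longrightarrow> smooth_point f y"
    "\<And>y. y \<in> ball z r \<Longrightarrow> (grad f has_derivative (*v) (hessian f y)) (at y)"
    "\<And>y u. y \<in> ball z r \<Longrightarrow> (hessian f y *v u) \<bullet> u \<le> L * (norm u)\<^sup>2"
proof -
  obtain V where V: "open V" "z \<in> V" "continuous_on V (hessian f)"
    "\<And>y. y \<in> V \<Longrightarrow> smooth_point f y"
    "\<And>y. y \<in> V \<Longrightarrow> (grad f has_derivative (*v) (hessian f y)) (at y)"
    using C2_aroundE[OF C2] by metis
  define l where "l = max_eigenvalue (hessian f z)"
  define N where "N = real CARD('n) * real CARD('n)"
  have "N > 0" by (simp add: N_def)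
  define e where "e = (L - l) / N"
  have "e > 0" using L \<open>N > 0\<close> by (simp add: e_def l_def)
  have "isCont (hessian f) z" using V(1-3) by (simp add: continuous_on_eq_continuous_at)
  with \<open>e > 0\<close> obtain r1 where "r1 > 0" and r1: "\<And>y. dist y z < r1 \<Longrightarrow> dist (hessian f y) (hessian f z) < e"
    unfolding continuous_at_eps_delta by blast
  obtain r2 where "r2 > 0" and r2: "ball z r2 \<subseteq> V" using V(1,2) open_contains_ball by blast
  show ?thesis
  proof (rule that[of "min r1 r2"])
    show "0 < min r1 r2" using \<open>r1 > 0\<close> \<open>r2 > 0\<close> by simp
    fix y assume y: "y \<in> ball z (min r1 r2)"
    then have "y \<in> V" using r2 by auto
    then show "smooth_point f y" "(grad f has_derivative (*v) (hessian f y)) (at y)" by (auto intro: V)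
    fix u :: "real^'n"
    define D where "D = hessian f y - hessian f z"
    have "norm D < e" using r1[of y] y by (simp add: D_def dist_commute flip: dist_norm)
    moreover have "\<bar>D $ i $ j\<bar> \<le> norm D" for i j
      using component_le_norm_cart[of "D $ i" j] Finite_Cartesian_Product.norm_nth_le[of D i] by linarith
    ultimately have "\<bar>D $ i $ j\<bar> \<le> e" for i j by (meson less_imp_le order_trans)
    then have "onorm ((*v) D) \<le> N * e" unfolding N_def by (rule onorm_le_matrix_component)
    also have "\<dots> = L - l" using \<open>N > 0\<close> by (simp add: e_def)
    finally have "onorm ((*v) D) * norm u \<le> (L - l) * norm u" by (simp add: mult_right_mono)
    with onorm[OF matrix_vector_mul_bounded_linear, of D u]
    have "norm (D *v u) \<le> (L - l) * norm u" by (rule order_trans)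
    then have "norm (D *v u) * norm u \<le> (L - l) * norm u * norm u" by (simp add: mult_right_mono)
    with norm_cauchy_schwarz[of "D *v u" u] have "(D *v u) \<bullet> u \<le> (L - l) * (norm u)\<^sup>2"
      by (simp add: power2_eq_square)
    moreover have "(hessian f z *v u) \<bullet> u \<le> l * (norm u)\<^sup>2"
      unfolding l_def by (rule quadratic_form_le_max_eigenvalue[OF hessian_symmetric[OF C2]])
    moreover have "(hessian f y *v u) \<bullet> u = (D *v u) \<bullet> u + (hessian f z *v u) \<bullet> u"
      by (simp add: D_def matrix_vector_mult_diff_rdistrib inner_diff_left)
    ultimately show "(hessian f y *v u) \<bullet> u \<le> L * (norm u)\<^sup>2" by (simp add: algebra_simps)
  qed
qed

text \<open>On a ball around \<open>z\<close> the descent lemma makes the test succeed for all steps at most \<open>1/L\<close>.  So a rejected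
  trial exceeds \<open>1/L\<close>, and a step size that was reduced at all is \<open>\<theta>\<close> times a rejected trial.\<close>

lemma step_sizes_bounded_below:
  assumes st: "standing_assumptions f \<mu>" and "0 < \<mu>" and fbs: "FBS f \<mu> \<sigma> \<theta> x \<alpha>"
    and lim: "x \<longlonglongrightarrow> z" and opt: "- grad f z \<in> subdifferential (\<lambda>y. \<mu> * norm1 y) z"
    and C2: "C2_around f z" and L: "max_eigenvalue (hessian f z) < L" "0 < L"
  obtains N where "\<And>K k. N \<le> K \<Longrightarrow> K \<le> k \<Longrightarrow> min (\<alpha> K) (\<theta> / L) \<le> \<alpha> k"
proof -
  have \<theta>: "0 < \<theta>" "0 < \<sigma>" using fbs by (auto simp: FBS_def)
  obtain r where "0 < r" and r: "\<And>y. y \<in> ball z r \<Longrightarrow> smooth_point f y"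
    "\<And>y. y \<in> ball z r \<Longrightarrow> (grad f has_derivative (*v) (hessian f y)) (at y)"
    "\<And>y u. y \<in> ball z r \<Longrightarrow> (hessian f y *v u) \<bullet> u \<le> L * (norm u)\<^sup>2"
    using hessian_bounded_near[OF C2 L(1)] by metis
  have "isCont (grad f) z" by (rule has_derivative_continuous[OF C2_around_grad(2)[OF C2]])
  then have "(\<lambda>k. grad f (x k)) \<longlonglongrightarrow> grad f z" using lim by (rule isCont_tendsto_compose)
  then have "(\<lambda>k. norm (x k - z) + \<sigma> * norm (grad f (x k) - grad f z))
      \<longlonglongrightarrow> norm (z - z) + \<sigma> * norm (grad f z - grad f z)"
    using lim by (intro tendsto_intros)
  then have "(\<lambda>k. norm (x k - z) + \<sigma> * norm (grad f (x k) - grad f z)) \<longlonglongrightarrow> 0" by simp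
  from order_tendstoD(2)[OF this \<open>0 < r\<close>] obtain N
    where N: "\<And>k. N \<le> k \<Longrightarrow> norm (x k - z) + \<sigma> * norm (grad f (x k) - grad f z) < r"
    unfolding eventually_sequentially by blast
  have grad: "GDERIV (real_of_ereal \<circ> f) y :> grad f y" if "y \<in> ball z r" for y
    using r(1)[OF that] unfolding smooth_point_def by blast
  have acc: "accepts f \<mu> (x k) \<beta>" if "N \<le> k" "0 < \<beta>" "\<beta> \<le> \<sigma>" "\<beta> \<le> 1 / L" for k \<beta>
  proof -
    define p where "p = J f \<mu> (x k) \<beta>"
    have "norm (p - z) \<le> norm (x k - z) + \<beta> * norm (grad f (x k) - grad f z)"
      unfolding p_def using J_dist_minimizer_le[OF opt] that \<open>0 < \<mu>\<close> by simp
    also have "\<dots> \<le> norm (x k - z) + \<sigma> * norm (grad f (x k) - grad f z)"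
      using that by (intro add_left_mono mult_right_mono) auto
    also have "\<dots> < r" by (rule N[OF that(1)])
    finally have p: "p \<in> ball z r" by (simp add: dist_norm norm_minus_commute)
    have "0 \<le> \<sigma> * norm (grad f (x k) - grad f z)" using \<theta> by simp
    with N[OF that(1)] have xk: "x k \<in> ball z r" by (simp add: dist_norm norm_minus_commute)
    have "(real_of_ereal \<circ> f) p \<le> (real_of_ereal \<circ> f) (x k) + grad f (x k) \<bullet> (p - x k) + L / 2 * (norm (p - x k))\<^sup>2"
      by (rule descent_lemma[OF convex_ball xk p grad r(2,3)])
    moreover have "L / 2 * (norm (p - x k))\<^sup>2 \<le> (norm (p - x k))\<^sup>2 / (2 * \<beta>)"
    proof -
      have "L / 2 \<le> 1 / (2 * \<beta>)" using that(2,4) \<open>0 < L\<close> by (simp add: field_simps)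
      from mult_right_mono[OF this, of "(norm (p - x k))\<^sup>2"] show ?thesis by simp
    qed
    ultimately show ?thesis
      using smooth_point_finite[OF r(1)[OF xk]] smooth_point_finite[OF r(1)[OF p]]
      by (intro acceptsI) (simp_all add: p_def)
  qed
  have step: "min (\<alpha> k) (\<theta> / L) \<le> \<alpha> (Suc k)" if "N \<le> k" for k
  proof -
    from FBS_step[OF st \<open>0 < \<mu>\<close> fbs, of "Suc k"] obtain i where pos: "0 < \<alpha> k" "\<alpha> k \<le> \<sigma>"
      and i: "\<alpha> (Suc k) = \<theta> ^ i * \<alpha> k" "\<And>j. j < i \<Longrightarrow> \<not> accepts f \<mu> (x (Suc k)) (\<theta> ^ j * \<alpha> k)" by auto
    show ?thesis
    proof (cases i)
      case 0
      with i show ?thesis by simp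
    next
      case (Suc j)
      have "\<theta> < 1" using fbs by (simp add: FBS_def)
      then have "\<theta> ^ j * \<alpha> k \<le> \<alpha> k"
        using pos \<theta> by (intro mult_left_le_one_le) (auto simp: power_le_one)
      then have "\<theta> ^ j * \<alpha> k \<le> \<sigma>" using pos(2) by (rule order_trans)
      then have "1 / L < \<theta> ^ j * \<alpha> k"
        using acc[of "Suc k" "\<theta> ^ j * \<alpha> k"] i(2)[of j] that pos \<theta> Suc by force
      then have "\<theta> * (1 / L) < \<theta> * (\<theta> ^ j * \<alpha> k)" using \<theta> by (intro mult_strict_left_mono)
      then show ?thesis using i(1) Suc by (simp add: mult.assoc)
    qed
  qed
  show ?thesis
  proof (rule that)
    fix K k assume "N \<le> K" "K \<le> k"
    from \<open>K \<le> k\<close> show "min (\<alpha> K) (\<theta> / L) \<le> \<alpha> k"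
    proof (induction rule: dec_induct)
      case (step n)
      then show ?case using \<open>N \<le> K\<close> step \<open>\<And>k. N \<le> k \<Longrightarrow> min (\<alpha> k) (\<theta> / L) \<le> \<alpha> (Suc k)\<close>[of n] by linarith
    qed simp
  qed
qed

section \<open>Linear rates\<close>

text \<open>For the function values put \<open>S = \<surd>(1 + a\<kappa>)\<close>, \<open>d = |x - z|\<close> and \<open>d' = |p - z|\<close>.  The contraction \<open>S d' \<le> d\<close>
  says exactly that \<open>(S - 1) (d + d') \<le> (S + 1) (d - d')\<close>.  Multiplied by \<open>d - d'\<close>, which is at most the
  length of the step, this bounds \<open>d\<^sup>2 - d'\<^sup>2\<close> and hence \<open>F' - Fz\<close> by a multiple of \<open>F - F'\<close>.\<close>

lemma contraction_from_growth:
  fixes p x z :: "'a::real_normed_vector" and A a \<kappa> F F' Fz :: real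
  assumes to_z: "2 * A * (F' - Fz) \<le> (norm (x - z))\<^sup>2 - (norm (p - z))\<^sup>2"
    and to_x: "(norm (p - x))\<^sup>2 \<le> 2 * A * (F - F')"
    and growth: "\<kappa> / 2 * (norm (p - z))\<^sup>2 \<le> F' - Fz"
    and "0 < a" "a \<le> A" "0 < \<kappa>"
  shows "norm (p - z) \<le> 1 / sqrt (1 + a * \<kappa>) * norm (x - z)"
    and "F' - Fz \<le> (sqrt (1 + a * \<kappa>) + 1) / (2 * sqrt (1 + a * \<kappa>)) * (F - Fz)"
proof -
  define S where "S = sqrt (1 + a * \<kappa>)"
  have S2: "S\<^sup>2 = 1 + a * \<kappa>" and "1 < S" using \<open>0 < a\<close> \<open>0 < \<kappa>\<close> by (simp_all add: S_def)
  define d where "d = norm (x - z)"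
  define d' where "d' = norm (p - z)"
  have [simp]: "0 \<le> d" "0 \<le> d'" by (simp_all add: d_def d'_def)
  have "0 < A" using assms by simp
  have "a * \<kappa> * d'\<^sup>2 \<le> A * \<kappa> * d'\<^sup>2" using assms by (intro mult_right_mono) auto
  also have "\<dots> = 2 * A * (\<kappa> / 2 * d'\<^sup>2)" by simp
  also have "\<dots> \<le> 2 * A * (F' - Fz)" using growth \<open>0 < A\<close> by (intro mult_left_mono) (auto simp: d'_def)
  also have "\<dots> \<le> d\<^sup>2 - d'\<^sup>2" using to_z by (simp add: d_def d'_def)
  finally have "(S * d')\<^sup>2 \<le> d\<^sup>2" by (simp add: power_mult_distrib S2 algebra_simps)
  then have contr: "S * d' \<le> d" by (rule power2_le_imp_le) simp
  then have "d' \<le> 1 / S * d" using \<open>1 < S\<close> by (simp add: pos_le_divide_eq mult.commute)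
  then show "norm (p - z) \<le> 1 / sqrt (1 + a * \<kappa>) * norm (x - z)" by (simp only: S_def d_def d'_def)
  have "d' \<le> S * d'" using \<open>1 < S\<close> by (simp add: mult_right_mono[of 1 S d', simplified])
  with contr have "d' \<le> d" by simp
  have "(S - 1) * (d + d') \<le> (S + 1) * (d - d')" using contr by (simp add: algebra_simps)
  from mult_right_mono[OF this, of "d - d'"] \<open>d' \<le> d\<close>
  have "(S - 1) * (d\<^sup>2 - d'\<^sup>2) \<le> (S + 1) * (d - d')\<^sup>2" by (simp add: power2_eq_square algebra_simps)
  also have "\<dots> \<le> (S + 1) * (norm (p - x))\<^sup>2"
  proof -
    have "d - d' \<le> norm (p - x)"
      using norm_triangle_ineq2[of "x - z" "p - z"] by (simp add: d_def d'_def norm_minus_commute)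
    with \<open>d' \<le> d\<close> \<open>1 < S\<close> show ?thesis by (intro mult_left_mono power_mono) auto
  qed
  also have "\<dots> \<le> (S + 1) * (2 * A * (F - F'))" using to_x \<open>1 < S\<close> by (intro mult_left_mono) auto
  finally have "(S - 1) * (d\<^sup>2 - d'\<^sup>2) \<le> (S + 1) * (2 * A * (F - F'))" .
  moreover have "(S - 1) * (2 * A * (F' - Fz)) \<le> (S - 1) * (d\<^sup>2 - d'\<^sup>2)"
    using to_z \<open>1 < S\<close> by (intro mult_left_mono) (auto simp: d_def d'_def)
  ultimately have "2 * A * ((S - 1) * (F' - Fz)) \<le> 2 * A * ((S + 1) * (F - F'))" by (simp add: algebra_simps)
  then have "(S - 1) * (F' - Fz) \<le> (S + 1) * (F - F')" using \<open>0 < A\<close> by simp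
  then have "(F' - Fz) * (2 * S) \<le> (S + 1) * (F - Fz)" by (simp add: algebra_simps)
  then have "F' - Fz \<le> (S + 1) / (2 * S) * (F - Fz)" using \<open>1 < S\<close> by (simp add: pos_le_divide_eq)
  then show "F' - Fz \<le> (sqrt (1 + a * \<kappa>) + 1) / (2 * sqrt (1 + a * \<kappa>)) * (F - Fz)" by (simp add: S_def)
qed

lemma FBS_eventual_rates:
  assumes st: "standing_assumptions f \<mu>" and "0 < \<mu>" and fbs: "FBS f \<mu> \<sigma> \<theta> x \<alpha>"
    and lim: "x \<longlonglongrightarrow> z" and z: "smooth_point f z" and "0 < \<kappa>"
    and growth: "\<forall>\<^sub>F y in nhds z. \<kappa> / 2 * (norm (y - z))\<^sup>2 \<le> real_F1 f \<mu> y - real_F1 f \<mu> z"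
  obtains N where "\<And>k a. N \<le> k \<Longrightarrow> 0 < a \<Longrightarrow> a \<le> \<alpha> k \<Longrightarrow>
      norm (x (Suc k) - z) \<le> 1 / sqrt (1 + a * \<kappa>) * norm (x k - z) \<and>
      real_F1 f \<mu> (x (Suc k)) - real_F1 f \<mu> z
        \<le> (sqrt (1 + a * \<kappa>) + 1) / (2 * sqrt (1 + a * \<kappa>)) * (real_F1 f \<mu> (x k) - real_F1 f \<mu> z)"
proof -
  have pf: "proper f" "convex_fun f" using st by (auto simp: standing_assumptions_def)
  from growth lim obtain N where N: "\<And>k. N \<le> k \<Longrightarrow>
      \<kappa> / 2 * (norm (x k - z))\<^sup>2 \<le> real_F1 f \<mu> (x k) - real_F1 f \<mu> z"
    unfolding filterlim_iff eventually_sequentially by blast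
  show ?thesis
  proof (rule that, rule conjI)
    fix k a assume k: "N \<le> k" and a: "0 < a" "a \<le> \<alpha> k"
    have "0 < \<alpha> k" using a by simp
    from FBS_step[OF st \<open>0 < \<mu>\<close> fbs, of k]
    have xk: "x k \<in> interior (effective_domain f)" and acc: "accepts f \<mu> (x k) (\<alpha> k)" by auto
    have sm: "smooth_point f (x k)" by (rule standing_assumptions_smooth_point[OF st xk])
    have next_x: "x (Suc k) = J f \<mu> (x k) (\<alpha> k)" using fbs by (simp add: FBS_def)
    have "f z < \<infinity>" "f (x k) < \<infinity>" using smooth_point_finite[OF z] smooth_point_finite[OF sm] by auto
    note ineq = forward_backward_inequality[OF pf sm _ \<open>0 < \<alpha> k\<close> less_imp_le[OF \<open>0 < \<mu>\<close>] acc, folded next_x]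
    have 1: "2 * \<alpha> k * (real_F1 f \<mu> (x (Suc k)) - real_F1 f \<mu> z) \<le> (norm (x k - z))\<^sup>2 - (norm (x (Suc k) - z))\<^sup>2"
      by (rule ineq) fact
    have 2: "(norm (x (Suc k) - x k))\<^sup>2 \<le> 2 * \<alpha> k * (real_F1 f \<mu> (x k) - real_F1 f \<mu> (x (Suc k)))"
      using ineq[OF \<open>f (x k) < \<infinity>\<close>] by (simp add: algebra_simps)
    have 3: "\<kappa> / 2 * (norm (x (Suc k) - z))\<^sup>2 \<le> real_F1 f \<mu> (x (Suc k)) - real_F1 f \<mu> z"
      using N[of "Suc k"] k by simp
    note rates = contraction_from_growth[OF 1 2 3 a \<open>0 < \<kappa>\<close>]
    show "norm (x (Suc k) - z) \<le> 1 / sqrt (1 + a * \<kappa>) * norm (x k - z)" by (rule rates)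
    show "real_F1 f \<mu> (x (Suc k)) - real_F1 f \<mu> z
        \<le> (sqrt (1 + a * \<kappa>) + 1) / (2 * sqrt (1 + a * \<kappa>)) * (real_F1 f \<mu> (x k) - real_F1 f \<mu> z)"
      by (rule rates)
  qed
qed

section \<open>Linear convergence of forward-backward splitting for the regularised problem\<close>

theorem corollary5p8:
  fixes f :: "real^'n \<Rightarrow> ereal" and \<mu> \<sigma> \<theta> :: real
    and x :: "nat \<Rightarrow> real^'n" and \<alpha> :: "nat \<Rightarrow> real" and xs :: "real^'n"
  assumes "standing_assumptions f \<mu>"
    and "0 < \<mu>"
    and "FBS f \<mu> \<sigma> \<theta> x \<alpha>"
    and "minimizers (F1 f \<mu>) \<noteq> {}"
    and "x \<longlonglongrightarrow> xs"
    and "xs \<in> minimizers (F1 f \<mu>)"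
    and "C2_around f xs"
    and "\<forall>u \<in> cone_U f \<mu> xs - {0}. (hessian_E f \<mu> xs *v u) \<bullet> u > 0"
  shows "Q_linearly_convergent x xs \<and>
    Q_linearly_convergent (\<lambda>k. real_of_ereal (F1 f \<mu> (x k))) (real_of_ereal (F1 f \<mu> xs)) \<and>
    (\<forall>\<kappa>. 0 < \<kappa> \<and> ereal \<kappa> < growth_const f \<mu> xs \<longrightarrow>
      (\<exists>K. \<forall>a. 0 < a \<and> ereal a < min (ereal (\<alpha> K / 2)) (step_bound f \<theta> xs) \<longrightarrow>
        (\<forall>k>K.
          norm (x (Suc k) - xs) \<le> 1 / sqrt (1 + a * \<kappa>) * norm (x k - xs) \<and>
          \<bar>F1 f \<mu> (x (Suc k)) - F1 f \<mu> xs\<bar>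
            \<le> ereal ((sqrt (1 + a * \<kappa>) + 1) / (2 * sqrt (1 + a * \<kappa>))) *
               \<bar>F1 f \<mu> (x k) - F1 f \<mu> xs\<bar>)))"
proof -
  note st = assms(1) and fbs = assms(3) and lim = assms(5) and min = assms(6) and C2 = assms(7)
  have \<theta>: "0 < \<theta>" "\<theta> < 1" "0 < \<sigma>" using fbs by (auto simp: FBS_def)
  have xk: "x k \<in> interior (effective_domain f)" and \<alpha>_pos: "0 < \<alpha> k" and \<alpha>_le: "\<alpha> k \<le> \<sigma>" for k
    using FBS_step[OF st \<open>0 < \<mu>\<close> fbs, of k] FBS_step[OF st \<open>0 < \<mu>\<close> fbs, of "Suc k"] by auto
  have "F1 f \<mu> xs \<le> F1 f \<mu> (x 0)" using min by (simp add: minimizers_def)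
  then have "xs \<in> interior (effective_domain f)" by (rule standing_assumptions_sublevel[OF st xk])
  then have z: "smooth_point f xs" by (rule standing_assumptions_smooth_point[OF st])
  have opt: "- grad f xs \<in> subdifferential (\<lambda>y. \<mu> * norm1 y) xs"
    using minimizer_subgradient[OF min _ z] \<open>0 < \<mu>\<close> by simp
  have F1_z: "F1 f \<mu> xs = ereal (real_F1 f \<mu> xs)" by (rule F1_eq_real_F1) (rule smooth_point_finite[OF z])
  have F1_x: "F1 f \<mu> (x k) = ereal (real_F1 f \<mu> (x k))" for k
    by (rule F1_eq_real_F1) (rule smooth_point_finite[OF standing_assumptions_smooth_point[OF st xk]])
  have F1_ge: "real_F1 f \<mu> xs \<le> real_F1 f \<mu> (x k)" for k
    using min F1_z F1_x[of k] by (simp add: minimizers_def) (metis ereal_less_eq(3))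
  define l where "l = max_eigenvalue (hessian f xs)"
  \<comment> \<open>When the largest eigenvalue \<open>l\<close> is positive, \<open>\<theta>/L\<close> is the quotient in the claim.  Otherwise
    \<open>\<theta>/L = \<sigma>\<close> is an upper bound for all step sizes, so that only \<open>\<alpha>\<^sub>K\<close> limits \<open>a\<close>.\<close>
  define L where "L = (if 0 < l then 2 * l else \<theta> / \<sigma>)"
  have "l < L" "0 < L" using \<theta> by (auto simp: L_def intro: le_less_trans[of _ 0])
  from step_sizes_bounded_below[OF st \<open>0 < \<mu>\<close> fbs lim opt C2 this(1)[unfolded l_def] this(2)]
  obtain N where N: "\<And>K k. N \<le> K \<Longrightarrow> K \<le> k \<Longrightarrow> min (\<alpha> K) (\<theta> / L) \<le> \<alpha> k" by metis
  have rates: "\<exists>M. \<forall>k\<ge>M. \<forall>a. 0 < a \<longrightarrow> a \<le> \<alpha> k \<longrightarrow>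
      norm (x (Suc k) - xs) \<le> 1 / sqrt (1 + a * \<kappa>) * norm (x k - xs) \<and>
      real_F1 f \<mu> (x (Suc k)) - real_F1 f \<mu> xs
        \<le> (sqrt (1 + a * \<kappa>) + 1) / (2 * sqrt (1 + a * \<kappa>)) * (real_F1 f \<mu> (x k) - real_F1 f \<mu> xs)"
    if "0 < \<kappa>" and pos: "\<And>u. u \<in> cone_U f \<mu> xs \<Longrightarrow> u \<noteq> 0 \<Longrightarrow> \<kappa> * (norm u)\<^sup>2 < (hessian_E f \<mu> xs *v u) \<bullet> u"
    for \<kappa>
    using FBS_eventual_rates[OF st \<open>0 < \<mu>\<close> fbs lim z \<open>0 < \<kappa>\<close>
        quadratic_growth[OF C2_around_grad[OF C2] opt \<open>0 < \<mu>\<close> pos]] by metis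
  obtain \<kappa>0 where \<kappa>0: "0 < \<kappa>0"
    "\<And>u. u \<in> cone_U f \<mu> xs \<Longrightarrow> u \<noteq> 0 \<Longrightarrow> \<kappa>0 * (norm u)\<^sup>2 < (hessian_E f \<mu> xs *v u) \<bullet> u"
    using uniform_growth_exists[OF assms(8)] by metis
  from rates[OF this] obtain M where M: "\<And>k a. M \<le> k \<Longrightarrow> 0 < a \<Longrightarrow> a \<le> \<alpha> k \<Longrightarrow>
      norm (x (Suc k) - xs) \<le> 1 / sqrt (1 + a * \<kappa>0) * norm (x k - xs) \<and>
      real_F1 f \<mu> (x (Suc k)) - real_F1 f \<mu> xs
        \<le> (sqrt (1 + a * \<kappa>0) + 1) / (2 * sqrt (1 + a * \<kappa>0)) * (real_F1 f \<mu> (x k) - real_F1 f \<mu> xs)"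
    by blast
  define m where "m = min (\<alpha> N) (\<theta> / L)"
  have "0 < m" using \<alpha>_pos \<theta> \<open>0 < L\<close> by (simp add: m_def)
  define S where "S = sqrt (1 + m * \<kappa>0)"
  have "1 < S" using \<open>0 < m\<close> \<kappa>0(1) by (simp add: S_def)
  have Q: "norm (x (Suc k) - xs) \<le> 1 / S * norm (x k - xs)"
    "real_F1 f \<mu> (x (Suc k)) - real_F1 f \<mu> xs \<le> (S + 1) / (2 * S) * (real_F1 f \<mu> (x k) - real_F1 f \<mu> xs)"
    if "max M N \<le> k" for k
    using M[of k m] N[of N k] \<open>0 < m\<close> that by (simp_all add: S_def m_def)
  have "Q_linearly_convergent x xs"
    unfolding Q_linearly_convergent_def
    by (intro exI[of _ "1 / S"] exI[of _ "max M N"]) (use Q(1) \<open>1 < S\<close> in auto)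
  moreover have "Q_linearly_convergent (\<lambda>k. real_of_ereal (F1 f \<mu> (x k))) (real_of_ereal (F1 f \<mu> xs))"
    unfolding Q_linearly_convergent_def
  proof (intro exI[of _ "(S + 1) / (2 * S)"] exI[of _ "max M N"] conjI allI impI)
    show "0 < (S + 1) / (2 * S)" "(S + 1) / (2 * S) < 1" using \<open>1 < S\<close> by auto
    fix k assume "max M N \<le> k"
    from Q(2)[OF this] F1_ge[of k] F1_ge[of "Suc k"]
    show "norm (real_of_ereal (F1 f \<mu> (x (Suc k))) - real_of_ereal (F1 f \<mu> xs))
        \<le> (S + 1) / (2 * S) * norm (real_of_ereal (F1 f \<mu> (x k)) - real_of_ereal (F1 f \<mu> xs))"
      by (simp add: F1_x F1_z)
  qed
  moreover have "\<exists>K. \<forall>a. 0 < a \<and> ereal a < min (ereal (\<alpha> K / 2)) (step_bound f \<theta> xs) \<longrightarrow>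
        (\<forall>k>K.
          norm (x (Suc k) - xs) \<le> 1 / sqrt (1 + a * \<kappa>) * norm (x k - xs) \<and>
          \<bar>F1 f \<mu> (x (Suc k)) - F1 f \<mu> xs\<bar>
            \<le> ereal ((sqrt (1 + a * \<kappa>) + 1) / (2 * sqrt (1 + a * \<kappa>))) *
               \<bar>F1 f \<mu> (x k) - F1 f \<mu> xs\<bar>)"
    if \<kappa>: "0 < \<kappa>" "ereal \<kappa> < growth_const f \<mu> xs" for \<kappa>
  proof -
    from rates[OF \<kappa>(1) growth_const_less[OF \<kappa>(2)]] obtain M where M: "\<And>k a. M \<le> k \<Longrightarrow> 0 < a \<Longrightarrow> a \<le> \<alpha> k \<Longrightarrow>
        norm (x (Suc k) - xs) \<le> 1 / sqrt (1 + a * \<kappa>) * norm (x k - xs) \<and>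
        real_F1 f \<mu> (x (Suc k)) - real_F1 f \<mu> xs
          \<le> (sqrt (1 + a * \<kappa>) + 1) / (2 * sqrt (1 + a * \<kappa>)) * (real_F1 f \<mu> (x k) - real_F1 f \<mu> xs)"
      by blast
    define K where "K = max M N"
    show ?thesis
    proof (intro exI[of _ K] allI impI)
      fix a k assume a: "0 < a \<and> ereal a < min (ereal (\<alpha> K / 2)) (step_bound f \<theta> xs)" and "K < k"
      have "a < \<alpha> K / 2" "ereal a < step_bound f \<theta> xs" using a by auto
      then have "a \<le> \<alpha> K" using \<alpha>_pos[of K] by simp
      have "a \<le> \<theta> / L"
      proof (cases "0 < l")
        case True
        then show ?thesis using \<open>ereal a < step_bound f \<theta> xs\<close> by (simp add: step_bound_def L_def flip: l_def)
      next
        case False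
        then have "\<theta> / L = \<sigma>" using \<theta> by (simp add: L_def)
        with \<open>a \<le> \<alpha> K\<close> \<alpha>_le[of K] show ?thesis by simp
      qed
      with \<open>a \<le> \<alpha> K\<close> N[of K k] \<open>K < k\<close> have "a \<le> \<alpha> k" by (simp add: K_def)
      with M[of k a] a \<open>K < k\<close> have
        1: "norm (x (Suc k) - xs) \<le> 1 / sqrt (1 + a * \<kappa>) * norm (x k - xs)" and
        2: "real_F1 f \<mu> (x (Suc k)) - real_F1 f \<mu> xs
          \<le> (sqrt (1 + a * \<kappa>) + 1) / (2 * sqrt (1 + a * \<kappa>)) * (real_F1 f \<mu> (x k) - real_F1 f \<mu> xs)"
        by (auto simp: K_def)
      have "\<bar>F1 f \<mu> (x k) - F1 f \<mu> xs\<bar> = ereal (real_F1 f \<mu> (x k) - real_F1 f \<mu> xs)" for k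
        using F1_ge[of k] by (simp add: F1_x F1_z)
      with 1 2 show "norm (x (Suc k) - xs) \<le> 1 / sqrt (1 + a * \<kappa>) * norm (x k - xs) \<and>
          \<bar>F1 f \<mu> (x (Suc k)) - F1 f \<mu> xs\<bar>
            \<le> ereal ((sqrt (1 + a * \<kappa>) + 1) / (2 * sqrt (1 + a * \<kappa>))) * \<bar>F1 f \<mu> (x k) - F1 f \<mu> xs\<bar>"
        by simp
    qed
  qed
  ultimately show ?thesis by blast
qed

end
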